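(* Let $l/k$ be a finite separable field extension with norm $n_{l/k}$, let $d_0\ge1$, and suppose $\mathrm{char}\,k=0$ or $\mathrm{char}\,k>[l:k]\cdot d_0$. Let $\varphi_0:V\to l$ be a nondegenerate form of degree $d_0$ over $l$. Define $\varphi:V\to k$, with $V$ regarded as a $k$-vector space, by $$\varphi(v)=n_{l/k}(\varphi_0(v)).$$ (i) If $\varphi_0$ is strongly multiplicative (respectively, strongly Jordan multiplicative), then $\varphi$ is a strongly multiplicative (respectively, strongly Jordan multiplicative) form of degree $[l:k]\cdot d_0$ over $k$. (ii) If $\varphi_0$ is multiplicative (respectively, Jordan multiplicative), then $\varphi$ is a multiplicative (respectively, Jordan multiplicative) form of degree $[l:k]\cdot d_0$ over $k$.
   Context: A form of degree $d$ on a finite-dimensional vector space $V$ over a field $F$ is a map $\varphi:V\to F$ which in coordinates is given by a homogeneous polynomial of degree $d$ over $F$; it corresponds to a unique symmetric $d$-linear form $\theta$ with $\varphi(v)=\theta(v,\dots,v)$, and it is nondegenerate if $v=0$ is the only vector with $\theta(v,v_2,\dots,v_d)=0$ for all $v_i\in V$. Two forms of degree $d$ are isomorphic ($\cong$) if they correspond to each other under a bijective linear map of the underlying spaces. Let $\varphi$ be a form over a field $F$ of dimension $n=\dim_F V$, identified with a homogeneous polynomial in $n$ variables via a basis; let $X=(x_1,\dots,x_n)$, $Y=(y_1,\dots,y_n)$ be independent indeterminates over $F$. Then $\varphi$ is: multiplicative if $\varphi(X)\varphi(Y)=\varphi(z_1,\dots,z_n)$ for suitable $z_1,\dots,z_n\in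 F(X,Y)$; strongly multiplicative if $\varphi(X)\varphi\cong\varphi$ over $F(X)$ (after extension of scalars); Jordan multiplicative if $\varphi(X)^2\varphi(Y)=\varphi(z_1,\dots,z_n)$ for suitable $z_1,\dots,z_n\in F(X,Y)$; strongly Jordan multiplicative if $\varphi(X)^2\varphi\cong\varphi$ over $F(X)$. These notions are applied to $\varphi_0$ over $F=l$ and to $\varphi$ over $F=k$ (where $\varphi$ has dimension $[l:k]\cdot\dim_lV$). *)

theory Defs
  imports
    "Jordan_Normal_Form.Determinant"
    "HOL-Library.Poly_Mapping"
    "HOL-Computational_Algebra.Polynomial"
    "HOL-Computational_Algebra.Fraction_Field"
begin

definition ordered_basis :: "('f::field \<Rightarrow> 'v::ab_group_add \<Rightarrow> 'v) \<Rightarrow> 'v list \<Rightarrow> bool" where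
  "ordered_basis scale bs \<longleftrightarrow>
     distinct bs \<and> \<not> Modules.module.dependent scale (set bs) \<and> Modules.module.span scale (set bs) = UNIV"

definition coord :: "('f::field \<Rightarrow> 'v::ab_group_add \<Rightarrow> 'v) \<Rightarrow> 'v list \<Rightarrow> 'v \<Rightarrow> nat \<Rightarrow> 'f" where
  "coord scale bs v i = Modules.module.representation scale (set bs) v (bs ! i)"

text \<open>An extension $l/k$ is given by an embedding \<open>\<iota>\<close> of the field \<open>'k\<close> into the field \<open>'l\<close>.\<close>

definition restrict_scale :: "('k::field \<Rightarrow> 'l::field) \<Rightarrow> ('l \<Rightarrow> 'v \<Rightarrow> 'v) \<Rightarrow> 'k \<Rightarrow> 'v \<Rightarrow> 'v" where
  "restrict_scale \<iota> scale c v = scale (\<iota> c) v"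

abbreviation ext_scale :: "('k::field \<Rightarrow> 'l::field) \<Rightarrow> 'k \<Rightarrow> 'l \<Rightarrow> 'l" where
  "ext_scale \<iota> \<equiv> restrict_scale \<iota> (*)"

definition finite_ext :: "('k::field \<Rightarrow> 'l::field) \<Rightarrow> bool" where
  "finite_ext \<iota> \<longleftrightarrow> field_hom \<iota> \<and> (\<exists>B. finite_dimensional_vector_space (ext_scale \<iota>) B)"

text \<open>The polynomial \<open>p\<close> below is, up to a unit, the minimal polynomial of \<open>a\<close>.\<close>

definition separable_ext :: "('k::field \<Rightarrow> 'l::field) \<Rightarrow> bool" where
  "separable_ext \<iota> \<longleftrightarrow>
     (\<forall>a. \<exists>p. irreducible p \<and> poly (map_poly \<iota> p) a = 0 \<and> coprime p (pderiv p))"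

definition ext_degree :: "('k::field \<Rightarrow> 'l::field) \<Rightarrow> nat" where
  "ext_degree \<iota> = vector_space.dim (ext_scale \<iota>) (UNIV :: 'l set)"

text \<open>The determinant of multiplication by \<open>a\<close> does not depend on the chosen basis.\<close>

definition field_norm :: "('k::field \<Rightarrow> 'l::field) \<Rightarrow> 'l \<Rightarrow> 'k" where
  "field_norm \<iota> a =
     (let bs = (SOME bs. ordered_basis (ext_scale \<iota>) bs); m = length bs
      in det (mat m m (\<lambda>(i, j). coord (ext_scale \<iota>) bs (a * bs ! j) i)))"

text \<open>Polynomials over \<open>'f\<close> in the variables $x_0, x_1, \dots$; a monomial is its finitely supported
  exponent function.\<close>

type_synonym 'f mpoly = "(nat \<Rightarrow>\<^sub>0 nat) \<Rightarrow>\<^sub>0 'f"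

definition in_vars :: "nat \<Rightarrow> 'f::zero mpoly \<Rightarrow> bool" where
  "in_vars n p \<longleftrightarrow> (\<forall>m \<in> Poly_Mapping.keys p. Poly_Mapping.keys m \<subseteq> {..<n})"

definition homogeneous :: "nat \<Rightarrow> 'f::zero mpoly \<Rightarrow> bool" where
  "homogeneous d p \<longleftrightarrow>
     (\<forall>m \<in> Poly_Mapping.keys p. (\<Sum>i \<in> Poly_Mapping.keys m. Poly_Mapping.lookup m i) = d)"

definition eval_mpoly ::
  "('f::zero \<Rightarrow> 'a::comm_ring_1) \<Rightarrow> 'f mpoly \<Rightarrow> (nat \<Rightarrow> 'a) \<Rightarrow> 'a" where
  "eval_mpoly h p x =
     (\<Sum>m \<in> Poly_Mapping.keys p. h (Poly_Mapping.lookup p m) *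
        (\<Prod>i \<in> Poly_Mapping.keys m. x i ^ Poly_Mapping.lookup m i))"

text \<open>The type below has infinitely many variables; the field $F(x_0,\dots,x_{N-1})$ is the subfield
  \<open>rat_funs N\<close>.\<close>

type_synonym 'f ratfun = "'f mpoly fract"

definition rat_funs :: "nat \<Rightarrow> 'f::field ratfun set" where
  "rat_funs N = {Fract p q | p q. in_vars N p \<and> in_vars N q \<and> q \<noteq> 0}"

definition rat_const :: "'f::field \<Rightarrow> 'f ratfun" where
  "rat_const c = Fract (Poly_Mapping.single 0 c) 1"

definition rat_var :: "nat \<Rightarrow> 'f::field ratfun" where
  "rat_var i = Fract (Poly_Mapping.single (Poly_Mapping.single i 1) 1) 1"

definition coord_poly ::
  "('f::field \<Rightarrow> 'v::ab_group_add \<Rightarrow> 'v) \<Rightarrow> 'v list \<Rightarrow> nat \<Rightarrow> ('v \<Rightarrow> 'f) \<Rightarrow> 'f mpoly \<Rightarrow> bool" where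
  "coord_poly scale bs d \<phi> p \<longleftrightarrow>
     ordered_basis scale bs \<and> in_vars (length bs) p \<and> homogeneous d p \<and>
     (\<forall>v. \<phi> v = eval_mpoly id p (coord scale bs v))"

definition is_form ::
  "('f::field \<Rightarrow> 'v::ab_group_add \<Rightarrow> 'v) \<Rightarrow> nat \<Rightarrow> ('v \<Rightarrow> 'f) \<Rightarrow> bool" where
  "is_form scale d \<phi> \<longleftrightarrow> (\<exists>bs p. coord_poly scale bs d \<phi> p)"

text \<open>A \<open>d\<close>-linear form takes its arguments as a list of length \<open>d\<close>.\<close>

definition sym_multilinear ::
  "('f::field \<Rightarrow> 'v::ab_group_add \<Rightarrow> 'v) \<Rightarrow> nat \<Rightarrow> ('v list \<Rightarrow> 'f) \<Rightarrow> bool" where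
  "sym_multilinear scale d \<theta> \<longleftrightarrow>
     (\<forall>vs i. length vs = d \<and> i < d \<longrightarrow> Vector_Spaces.linear scale (*) (\<lambda>x. \<theta> (vs[i := x]))) \<and>
     (\<forall>vs ws. length vs = d \<and> mset vs = mset ws \<longrightarrow> \<theta> vs = \<theta> ws)"

text \<open>If the characteristic is \<open>0\<close> or exceeds \<open>d\<close>, the values of \<open>\<theta>\<close> on lists of length \<open>d\<close> are
  determined by \<open>\<phi>\<close> (polarization).\<close>

definition nondegenerate ::
  "('f::field \<Rightarrow> 'v::ab_group_add \<Rightarrow> 'v) \<Rightarrow> nat \<Rightarrow> ('v \<Rightarrow> 'f) \<Rightarrow> bool" where
  "nondegenerate scale d \<phi> \<longleftrightarrow>
     (\<exists>\<theta>. sym_multilinear scale d \<theta> \<and> (\<forall>v. \<phi> v = \<theta> (replicate d v)) \<and>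
        (\<forall>v. (\<forall>vs. length vs = d - 1 \<longrightarrow> \<theta> (v # vs) = 0) \<longrightarrow> v = 0))"

text \<open>The field \<open>K\<close> is a subfield of \<open>'a\<close>, in the application \<open>rat_funs n\<close>; hence linearity is
  relative to \<open>K\<close> and to the carrier $K^n$.\<close>

definition coord_space :: "'a::field set \<Rightarrow> nat \<Rightarrow> 'a vec set" where
  "coord_space K n = {v \<in> carrier_vec n. \<forall>i<n. v $ i \<in> K}"

definition isomorphic_forms ::
  "'a::field set \<Rightarrow> nat \<Rightarrow> ('a vec \<Rightarrow> 'a) \<Rightarrow> ('a vec \<Rightarrow> 'a) \<Rightarrow> bool" where
  "isomorphic_forms K n \<phi> \<psi> \<longleftrightarrow>
     (\<exists>f. bij_betw f (coord_space K n) (coord_space K n) \<and>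
        (\<forall>u \<in> coord_space K n. \<forall>v \<in> coord_space K n. f (u + v) = f u + f v) \<and>
        (\<forall>c \<in> K. \<forall>v \<in> coord_space K n. f (c \<cdot>\<^sub>v v) = c \<cdot>\<^sub>v f v) \<and>
        (\<forall>v \<in> coord_space K n. \<psi> (f v) = \<phi> v))"

text \<open>In the following, \<open>p\<close> is a polynomial in \<open>n\<close> variables, $X = (x_0,\dots,x_{n-1})$ and
  $Y = (x_n,\dots,x_{2n-1})$.\<close>

definition generic_X :: "'f::field mpoly \<Rightarrow> 'f ratfun" where
  "generic_X p = eval_mpoly rat_const p rat_var"

definition generic_Y :: "nat \<Rightarrow> 'f::field mpoly \<Rightarrow> 'f ratfun" where
  "generic_Y n p = eval_mpoly rat_const p (\<lambda>i. rat_var (n + i))"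

definition scalar_ext :: "'f::field mpoly \<Rightarrow> 'f ratfun vec \<Rightarrow> 'f ratfun" where
  "scalar_ext p v = eval_mpoly rat_const p (\<lambda>i. v $ i)"

definition multiplicative_poly :: "nat \<Rightarrow> 'f::field mpoly \<Rightarrow> bool" where
  "multiplicative_poly n p \<longleftrightarrow>
     (\<exists>z. (\<forall>i<n. z i \<in> rat_funs (2 * n)) \<and>
        generic_X p * generic_Y n p = eval_mpoly rat_const p z)"

definition jordan_multiplicative_poly :: "nat \<Rightarrow> 'f::field mpoly \<Rightarrow> bool" where
  "jordan_multiplicative_poly n p \<longleftrightarrow>
     (\<exists>z. (\<forall>i<n. z i \<in> rat_funs (2 * n)) \<and>
        (generic_X p)\<^sup>2 * generic_Y n p = eval_mpoly rat_const p z)"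

definition strongly_multiplicative_poly :: "nat \<Rightarrow> 'f::field mpoly \<Rightarrow> bool" where
  "strongly_multiplicative_poly n p \<longleftrightarrow>
     isomorphic_forms (rat_funs n) n (\<lambda>v. generic_X p * scalar_ext p v) (scalar_ext p)"

definition strongly_jordan_multiplicative_poly :: "nat \<Rightarrow> 'f::field mpoly \<Rightarrow> bool" where
  "strongly_jordan_multiplicative_poly n p \<longleftrightarrow>
     isomorphic_forms (rat_funs n) n (\<lambda>v. (generic_X p)\<^sup>2 * scalar_ext p v) (scalar_ext p)"

text \<open>A property of homogeneous polynomials is transferred to forms through a basis. The properties
  above are invariant under linear changes of coordinates, and if the characteristic is \<open>0\<close> or
  exceeds \<open>d\<close> then \<open>p\<close> is determined by \<open>\<phi>\<close> and \<open>bs\<close>; so the choices do not matter.\<close>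

definition via_basis ::
  "(nat \<Rightarrow> 'f::field mpoly \<Rightarrow> bool) \<Rightarrow>
   ('f \<Rightarrow> 'v::ab_group_add \<Rightarrow> 'v) \<Rightarrow> nat \<Rightarrow> ('v \<Rightarrow> 'f) \<Rightarrow> bool" where
  "via_basis P scale d \<phi> \<longleftrightarrow> (\<exists>bs p. coord_poly scale bs d \<phi> p \<and> P (length bs) p)"

abbreviation "multiplicative_form \<equiv> via_basis multiplicative_poly"
abbreviation "jordan_multiplicative_form \<equiv> via_basis jordan_multiplicative_poly"
abbreviation "strongly_multiplicative_form \<equiv> via_basis strongly_multiplicative_poly"
abbreviation "strongly_jordan_multiplicative_form \<equiv> via_basis strongly_jordan_multiplicative_poly"

end

theory Submission
  imports Defs
begin

text \<open>Let \<open>a\<^sub>0, \<dots>, a\<^sub>m\<^sub>-\<^sub>1\<close> be a basis of \<open>l\<close> over \<open>k\<close>. A vector of \<open>V\<close> with coordinates \<open>v\<^sub>i \<in> l\<close> is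
  described over \<open>k\<close> by the elements \<open>x\<^sub>i\<^sub>j\<close> with \<open>v\<^sub>i = \<Sum>\<^sub>j a\<^sub>j x\<^sub>i\<^sub>j\<close>. The norm of an element of \<open>l\<close> is the
  determinant of its multiplication matrix, whose entries are linear in the coordinates of the
  element. So if \<open>p\<close> is the polynomial of \<open>\<phi>\<^sub>0\<close>, then \<open>\<phi>\<close> is given by a polynomial \<open>P\<close> over \<open>k\<close>, the
  determinant belonging to \<open>p (\<Sum>\<^sub>j a\<^sub>j x\<^sub>i\<^sub>j)\<close>, and \<open>P\<close> is homogeneous of degree \<open>m\<close> times the degree of
  \<open>p\<close> (\<open>norm_poly\<close>, \<open>coord_poly_norm_poly\<close>).

  The elements \<open>a\<^sub>j\<close> are also a basis of \<open>l(x\<^sub>i\<^sub>j)\<close> over \<open>k(x\<^sub>i\<^sub>j)\<close>, with the same structure constants.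
  Hence the same determinant is a multiplicative map from \<open>l(x\<^sub>i\<^sub>j)\<close> to \<open>k(x\<^sub>i\<^sub>j)\<close>, and it sends the
  value of \<open>p\<close> at \<open>v\<close> to the value of \<open>P\<close> at the \<open>k(x\<^sub>i\<^sub>j)\<close>-coordinates of \<open>v\<close>. Therefore an identity
  \<open>p(u)\<^sup>s p(v) = p(w)\<close> over \<open>l(x\<^sub>i\<^sub>j)\<close> gives the corresponding identity for \<open>P\<close>
  (\<open>norm_poly_similarity\<close>).

  The hypotheses on \<open>p\<close> are identities over \<open>l(X)\<close> or \<open>l(X, Y)\<close>. They are carried to the field that
  is needed by the substitution \<open>x\<^sub>i \<mapsto> \<Sum>\<^sub>j a\<^sub>j x\<^sub>i\<^sub>j\<close> (\<open>spread\<close>), which is injective on polynomials and so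
  extends to the fraction fields; it turns \<open>p(X)\<close> into \<open>p\<close> at the generic vector, the norm of which is
  \<open>P(X)\<close>. For the multiplicative properties this is all (\<open>multiplicative_norm_poly\<close>). For the strong
  ones, the given isomorphism is a matrix \<open>A\<close> over \<open>l(X)\<close> with \<open>p(Av) = p(X)\<^sup>s p(v)\<close> for all \<open>v\<close> over
  \<open>l(X)\<close>. If there are variables at all, then \<open>l(X)\<close> is infinite, so this is an identity of polynomials in \<open>v\<close>, and it survives the
  substitution (\<open>similarity_extends\<close>); restricting scalars from \<open>l(x\<^sub>i\<^sub>j)\<close> to \<open>k(x\<^sub>i\<^sub>j)\<close> in the
  transformed matrix gives the isomorphism for \<open>P\<close> (\<open>strongly_multiplicative_norm_poly\<close>).

  The exponent \<open>s\<close> is \<open>1\<close> for the multiplicative and \<open>2\<close> for the Jordan multiplicative properties.\<close>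


section \<open>Subrings and subfields\<close>

definition ring_closed :: "'a::comm_ring_1 set \<Rightarrow> bool" where
  "ring_closed S \<longleftrightarrow> 0 \<in> S \<and> 1 \<in> S \<and>
     (\<forall>x\<in>S. - x \<in> S) \<and> (\<forall>x\<in>S. \<forall>y\<in>S. x + y \<in> S) \<and> (\<forall>x\<in>S. \<forall>y\<in>S. x * y \<in> S)"

definition field_closed :: "'a::field set \<Rightarrow> bool" where
  "field_closed S \<longleftrightarrow> ring_closed S \<and> (\<forall>x\<in>S. inverse x \<in> S)"

lemma ring_closed_simps:
  assumes "ring_closed S"
  shows "0 \<in> S" "1 \<in> S" "x \<in> S \<Longrightarrow> - x \<in> S" "x \<in> S \<Longrightarrow> y \<in> S \<Longrightarrow> x + y \<in> S"
    "x \<in> S \<Longrightarrow> y \<in> S \<Longrightarrow> x * y \<in> S"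
  using assms by (auto simp: ring_closed_def)

lemma field_closedD: "field_closed S \<Longrightarrow> ring_closed S" "field_closed S \<Longrightarrow> x \<in> S \<Longrightarrow> inverse x \<in> S"
  by (auto simp: field_closed_def)

lemma ring_closed_diff: "ring_closed S \<Longrightarrow> x \<in> S \<Longrightarrow> y \<in> S \<Longrightarrow> x - y \<in> S"
  using ring_closed_simps(3,4)[of S] by (metis diff_conv_add_uminus)

lemma ring_closed_sum:
  assumes "ring_closed S" "\<And>i. i \<in> I \<Longrightarrow> f i \<in> S"
  shows "sum f I \<in> S"
  using assms(2)
  by (induction I rule: infinite_finite_induct) (auto intro: ring_closed_simps[OF assms(1)])

lemma ring_closed_prod:
  assumes "ring_closed S" "\<And>i. i \<in> I \<Longrightarrow> f i \<in> S"
  shows "prod f I \<in> S"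
  using assms(2)
  by (induction I rule: infinite_finite_induct) (auto intro: ring_closed_simps[OF assms(1)])

lemma ring_closed_power: "ring_closed S \<Longrightarrow> x \<in> S \<Longrightarrow> x ^ k \<in> S"
  by (induction k) (auto intro: ring_closed_simps)

text \<open>By the Leibniz formula a determinant is a polynomial in its entries; used both for coordinates of
  inverses, which are cofactors divided by a determinant, and for the variables that occur in the
  norm polynomial.\<close>

lemma ring_closed_det:
  assumes "ring_closed S" "A \<in> carrier_mat n n" "\<And>i j. i < n \<Longrightarrow> j < n \<Longrightarrow> A $$ (i, j) \<in> S"
  shows "det A \<in> S"
proof -
  have "(signof p :: 'a) \<in> S" for p
    using ring_closed_simps[OF assms(1)] by (auto simp: sign_def)
  then show ?thesis
    unfolding det_def'[OF assms(2)] using assms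
    by (intro ring_closed_sum ring_closed_simps(5) ring_closed_prod) (auto simp: permutes_in_image)
qed

section \<open>Polynomials and their values\<close>

definition monomial_value :: "(nat \<Rightarrow> 'a::comm_ring_1) \<Rightarrow> (nat \<Rightarrow>\<^sub>0 nat) \<Rightarrow> 'a" where
  "monomial_value x m = (\<Prod>i\<in>Poly_Mapping.keys m. x i ^ Poly_Mapping.lookup m i)"

definition mconst :: "'f::comm_ring_1 \<Rightarrow> 'f mpoly" where
  "mconst c = Poly_Mapping.single 0 c"

definition mvar :: "nat \<Rightarrow> 'f::comm_ring_1 mpoly" where
  "mvar i = Poly_Mapping.single (Poly_Mapping.single i 1) 1"

lemma eval_mpoly_alt:
  "eval_mpoly h p x = (\<Sum>m\<in>Poly_Mapping.keys p. h (Poly_Mapping.lookup p m) * monomial_value x m)"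
  by (simp add: eval_mpoly_def monomial_value_def)

lemma monomial_value_superset:
  assumes "finite A" "Poly_Mapping.keys m \<subseteq> A"
  shows "monomial_value x m = (\<Prod>i\<in>A. x i ^ Poly_Mapping.lookup m i)"
  unfolding monomial_value_def
  by (rule prod.mono_neutral_left) (use assms in \<open>auto simp: in_keys_iff\<close>)

lemma monomial_value_0 [simp]: "monomial_value x 0 = 1"
  by (simp add: monomial_value_def)

lemma monomial_value_single [simp]: "monomial_value x (Poly_Mapping.single i k) = x i ^ k"
  by (cases "k = 0") (simp_all add: monomial_value_def)

lemma monomial_value_add: "monomial_value x (m + m') = monomial_value x m * monomial_value x m'"
proof -
  let ?A = "Poly_Mapping.keys m \<union> Poly_Mapping.keys m'"
  have "Poly_Mapping.keys (m + m') \<subseteq> ?A" by (rule Poly_Mapping.keys_add)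
  then have "monomial_value x (m + m') = (\<Prod>i\<in>?A. x i ^ Poly_Mapping.lookup (m + m') i)"
    by (intro monomial_value_superset) auto
  also have "\<dots> = (\<Prod>i\<in>?A. x i ^ Poly_Mapping.lookup m i) * (\<Prod>i\<in>?A. x i ^ Poly_Mapping.lookup m' i)"
    by (simp add: lookup_add power_add prod.distrib)
  also have "\<dots> = monomial_value x m * monomial_value x m'"
    by (simp add: monomial_value_superset[of ?A])
  finally show ?thesis .
qed

lemma eval_mpoly_superset:
  assumes "h 0 = 0" "finite A" "Poly_Mapping.keys p \<subseteq> A"
  shows "eval_mpoly h p x = (\<Sum>m\<in>A. h (Poly_Mapping.lookup p m) * monomial_value x m)"
  unfolding eval_mpoly_alt
  by (rule sum.mono_neutral_left) (use assms in \<open>auto simp: in_keys_iff\<close>)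

lemma mpoly_sum_single:
  "(\<Sum>m\<in>Poly_Mapping.keys p. Poly_Mapping.single m (Poly_Mapping.lookup p m)) = p"
  by (rule poly_mapping_eqI)
    (auto simp: lookup_sum lookup_single when_def in_keys_iff sum.delta)

lemma eval_mpoly_single: "h 0 = 0 \<Longrightarrow> eval_mpoly h (Poly_Mapping.single m c) x = h c * monomial_value x m"
  by (cases "c = 0") (simp_all add: eval_mpoly_alt)

text \<open>Both sides of the multiplication law are expanded into monomials, on which it is
  \<open>monomial_value_add\<close>.\<close>

lemma comm_ring_hom_eval_mpoly:
  fixes h :: "'f::comm_ring_1 \<Rightarrow> 'a::comm_ring_1"
  assumes "comm_ring_hom h"
  shows "comm_ring_hom (\<lambda>p. eval_mpoly h p x)"
proof -
  interpret comm_ring_hom h by fact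
  let ?e = "\<lambda>p. eval_mpoly h p x"
  have zero: "?e 0 = 0"
    by (simp add: eval_mpoly_alt)
  have add: "?e (p + q) = ?e p + ?e q" for p q
    unfolding eval_mpoly_alt
    by (rule setsum_keys_plus_distrib) (auto simp: hom_add algebra_simps)
  have sum: "?e (sum f I) = (\<Sum>i\<in>I. ?e (f i))" for I :: "(nat \<Rightarrow>\<^sub>0 nat) set" and f
    by (induction I rule: infinite_finite_induct) (auto simp: zero add)
  have one: "?e 1 = 1"
    using eval_mpoly_single[of h 0 1 x] by simp
  have mult: "?e (p * q) = ?e p * ?e q" for p q
  proof -
    let ?s = "\<lambda>p m. Poly_Mapping.single m (Poly_Mapping.lookup p m)"
    let ?k = Poly_Mapping.keys
    have "p * q = (\<Sum>m\<in>?k p. ?s p m) * (\<Sum>m\<in>?k q. ?s q m)"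
      by (simp add: mpoly_sum_single)
    also have "\<dots> = (\<Sum>m\<in>?k p. \<Sum>m'\<in>?k q.
        Poly_Mapping.single (m + m') (Poly_Mapping.lookup p m * Poly_Mapping.lookup q m'))"
      by (simp add: sum_product mult_single)
    finally have "?e (p * q) = (\<Sum>m\<in>?k p. \<Sum>m'\<in>?k q.
        h (Poly_Mapping.lookup p m * Poly_Mapping.lookup q m') * monomial_value x (m + m'))"
      by (simp add: sum eval_mpoly_single)
    also have "\<dots> = ?e p * ?e q"
      unfolding eval_mpoly_alt sum_product
      by (intro sum.cong) (auto simp: monomial_value_add hom_mult algebra_simps)
    finally show ?thesis .
  qed
  show ?thesis
    by unfold_locales (auto simp: zero one add mult)
qed


lemma eval_mpoly_mconst: "h 0 = 0 \<Longrightarrow> eval_mpoly h (mconst c) x = h c"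
  by (simp add: mconst_def eval_mpoly_single)

lemma eval_mpoly_mvar: "h 0 = 0 \<Longrightarrow> h 1 = 1 \<Longrightarrow> eval_mpoly h (mvar i) x = x i"
  by (simp add: mvar_def eval_mpoly_single del: One_nat_def)

lemma comm_ring_hom_mconst: "comm_ring_hom mconst"
  by unfold_locales (simp_all add: mconst_def mult_single single_add)

lemma hom_monomial_value:
  assumes "comm_ring_hom g"
  shows "g (monomial_value x m) = monomial_value (\<lambda>i. g (x i)) m"
proof -
  interpret comm_ring_hom g by fact
  show ?thesis by (simp add: monomial_value_def hom_prod hom_power)
qed

text \<open>With \<open>g\<close> itself an evaluation, this is the substitution rule for polynomials.\<close>

lemma hom_eval_mpoly:
  assumes "comm_ring_hom g"
  shows "g (eval_mpoly h p x) = eval_mpoly (\<lambda>c. g (h c)) p (\<lambda>i. g (x i))"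
proof -
  interpret comm_ring_hom g by fact
  show ?thesis
    by (simp add: eval_mpoly_alt hom_sum hom_mult hom_monomial_value[OF assms])
qed

lemma monomial_value_mvar: "monomial_value mvar m = Poly_Mapping.single m 1"
proof -
  have power: "mvar i ^ k = (Poly_Mapping.single (Poly_Mapping.single i k) 1 :: 'a mpoly)" for i k
    by (induction k) (simp_all add: mvar_def mult_single single_add[symmetric])
  have prod: "(\<Prod>i\<in>I. Poly_Mapping.single (f i) 1 :: 'a mpoly) = Poly_Mapping.single (sum f I) 1"
    for f :: "nat \<Rightarrow> (nat \<Rightarrow>\<^sub>0 nat)" and I
    by (induction I rule: infinite_finite_induct) (simp_all add: mult_single)
  have "(\<Sum>i\<in>Poly_Mapping.keys m. Poly_Mapping.single i (Poly_Mapping.lookup m i)) = m"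
    by (rule poly_mapping_eqI) (auto simp: lookup_sum lookup_single when_def in_keys_iff sum.delta)
  then show ?thesis
    by (simp add: monomial_value_def power prod)
qed

text \<open>Reduces questions about polynomials whose coefficients come from another ring by \<open>h\<close>, such as those
  of \<open>k[X]\<close> inside \<open>l[X]\<close>, to their coefficients.\<close>

lemma lookup_eval_mconst_mvar:
  assumes "h 0 = 0"
  shows "Poly_Mapping.lookup (eval_mpoly (\<lambda>c. mconst (h c)) p mvar) m = h (Poly_Mapping.lookup p m)"
  using assms
  by (auto simp: eval_mpoly_alt monomial_value_mvar mconst_def mult_single lookup_sum lookup_single
      when_def in_keys_iff sum.delta)

lemma eval_mpoly_mconst_mvar: "eval_mpoly mconst p mvar = p"
  by (rule poly_mapping_eqI) (use lookup_eval_mconst_mvar[of "\<lambda>c. c" p] in simp)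

lemma lookup_mconst_mult: "Poly_Mapping.lookup (mconst c * p) m = c * Poly_Mapping.lookup p m"
  by (simp add: mconst_def flip: mult_map_scale_conv_mult) (simp add: map.rep_eq when_def)

lemma eval_mpoly_cong:
  assumes "in_vars n p" "\<And>i. i < n \<Longrightarrow> x i = y i"
  shows "eval_mpoly h p x = eval_mpoly h p y"
  unfolding eval_mpoly_def
  using assms by (intro sum.cong prod.cong arg_cong2[where f = "(*)"]) (auto simp: in_vars_def subset_iff)

lemma eval_mpoly_closed:
  assumes "ring_closed S" "in_vars n p" "\<And>c. h c \<in> S" "\<And>i. i < n \<Longrightarrow> x i \<in> S"
  shows "eval_mpoly h p x \<in> S"
  unfolding eval_mpoly_def
  by (intro ring_closed_sum ring_closed_simps(5) ring_closed_prod ring_closed_power)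
    (use assms in \<open>auto simp: in_vars_def subset_iff\<close>)

lemma ring_closed_in_vars: "ring_closed {p :: 'f::comm_ring_1 mpoly. in_vars n p}"
proof -
  have "in_vars n (p + q)" if "in_vars n p" "in_vars n q" for p q :: "'f mpoly"
    using that Poly_Mapping.keys_add[of p q] unfolding in_vars_def by blast
  moreover have "in_vars n (p * q)" if "in_vars n p" "in_vars n q" for p q :: "'f mpoly"
  proof -
    have "Poly_Mapping.keys m \<subseteq> {..<n}" if m: "m \<in> Poly_Mapping.keys (p * q)" for m
    proof -
      obtain a b where "m = a + b" "a \<in> Poly_Mapping.keys p" "b \<in> Poly_Mapping.keys q"
        using m keys_mult[of p q] by blast
      then show ?thesis
        using \<open>in_vars n p\<close> \<open>in_vars n q\<close> Poly_Mapping.keys_add[of a b] unfolding in_vars_def by blast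
    qed
    then show ?thesis by (auto simp: in_vars_def)
  qed
  moreover have "in_vars n (- p)" if "in_vars n p" for p :: "'f mpoly"
    using that by (simp add: in_vars_def in_keys_iff)
  moreover have "in_vars n 0" "in_vars n 1"
    by (simp_all add: in_vars_def)
  ultimately show ?thesis
    by (simp add: ring_closed_def)
qed

lemma in_vars_mconst: "in_vars n (mconst c)"
  by (simp add: in_vars_def mconst_def)

lemma in_vars_mvar: "i < n \<Longrightarrow> in_vars n (mvar i)"
  by (auto simp: in_vars_def mvar_def split: if_splits)

definition mdegree :: "(nat \<Rightarrow>\<^sub>0 nat) \<Rightarrow> nat" where
  "mdegree m = (\<Sum>i\<in>Poly_Mapping.keys m. Poly_Mapping.lookup m i)"

lemma homogeneous_alt: "homogeneous d p \<longleftrightarrow> (\<forall>m\<in>Poly_Mapping.keys p. mdegree m = d)"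
  by (simp add: homogeneous_def mdegree_def)

lemma mdegree_add: "mdegree (m + m') = mdegree m + mdegree m'"
  unfolding mdegree_def by (rule setsum_keys_plus_distrib) auto

lemma homogeneous_0: "homogeneous d 0"
  by (simp add: homogeneous_def)

lemma homogeneous_mconst: "homogeneous 0 (mconst c)"
  by (simp add: homogeneous_def mconst_def)

lemma homogeneous_mvar: "homogeneous 1 (mvar i)"
  by (simp add: homogeneous_def mvar_def)

lemma homogeneous_add: "homogeneous d p \<Longrightarrow> homogeneous d q \<Longrightarrow> homogeneous d (p + q)"
  using Poly_Mapping.keys_add[of p q] unfolding homogeneous_alt by blast

lemma homogeneous_mult:
  assumes "homogeneous d p" "homogeneous e q"
  shows "homogeneous (d + e) (p * q)"
  unfolding homogeneous_alt
proof
  fix m assume "m \<in> Poly_Mapping.keys (p * q)"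
  then obtain a b where "m = a + b" "a \<in> Poly_Mapping.keys p" "b \<in> Poly_Mapping.keys q"
    using keys_mult[of p q] by blast
  then show "mdegree m = d + e"
    using assms by (simp add: homogeneous_alt mdegree_add)
qed

lemma homogeneous_mconst_mult: "homogeneous d p \<Longrightarrow> homogeneous d (mconst c * p)"
  using homogeneous_mult[OF homogeneous_mconst] by simp

lemma homogeneous_sum: "(\<And>i. i \<in> I \<Longrightarrow> homogeneous d (f i)) \<Longrightarrow> homogeneous d (sum f I)"
  by (induction I rule: infinite_finite_induct) (auto intro: homogeneous_0 homogeneous_add)

lemma homogeneous_1: "homogeneous 0 1"
  by (simp add: homogeneous_def)

lemma homogeneous_prod:
  "(\<And>i. i \<in> I \<Longrightarrow> homogeneous (d i) (f i)) \<Longrightarrow> homogeneous (sum d I) (prod f I)"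
  by (induction I rule: infinite_finite_induct) (auto intro: homogeneous_mult homogeneous_1)

lemma homogeneous_power: "homogeneous d p \<Longrightarrow> homogeneous (d * k) (p ^ k)"
  by (induction k) (auto intro: homogeneous_mult homogeneous_1)

lemma homogeneous_det:
  assumes "A \<in> carrier_mat n n" "\<And>i j. i < n \<Longrightarrow> j < n \<Longrightarrow> homogeneous d (A $$ (i, j))"
  shows "homogeneous (n * d) (det A)"
proof -
  have sign: "(signof p :: 'a mpoly) = mconst (signof p)" for p
    by (auto simp: mconst_def sign_def single_uminus)
  have "homogeneous (n * d) (\<Prod>i = 0..<n. A $$ (i, p i))" if "p permutes {0..<n}" for p
    using homogeneous_prod[of "{0..<n}" "\<lambda>_. d" "\<lambda>i. A $$ (i, p i)"] assms that
    by (auto simp: permutes_in_image)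
  then show ?thesis
    unfolding det_def'[OF assms(1)] sign
    by (intro homogeneous_sum homogeneous_mconst_mult) auto
qed

lemma homogeneous_eval_mpoly:
  assumes "homogeneous d p" "\<And>i. homogeneous 1 (x i)"
  shows "homogeneous d (eval_mpoly (\<lambda>c. mconst (h c)) p x)"
  unfolding eval_mpoly_alt
proof (intro homogeneous_sum homogeneous_mconst_mult)
  fix m assume "m \<in> Poly_Mapping.keys p"
  then have "d = (\<Sum>i\<in>Poly_Mapping.keys m. 1 * Poly_Mapping.lookup m i)"
    using assms by (simp add: homogeneous_def)
  then show "homogeneous d (monomial_value x m)"
    unfolding monomial_value_def by (simp only:) (intro homogeneous_prod homogeneous_power assms(2))
qed


text \<open>Induction on the number of variables: for fixed values of the first \<open>n\<close> variables the sum is a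
  polynomial in the last one with infinitely many zeros, so the terms with a given exponent of the
  last variable already cancel. Terms are indexed by an arbitrary set rather than by their exponents,
  so that the induction hypothesis applies to a subset of the same terms.\<close>

lemma monomials_independent:
  fixes c :: "'b \<Rightarrow> 'a::field" and e :: "'b \<Rightarrow> nat \<Rightarrow> nat"
  assumes "n > 0 \<Longrightarrow> infinite R" "finite T"
    and "\<And>s t. s \<in> T \<Longrightarrow> t \<in> T \<Longrightarrow> (\<And>i. i < n \<Longrightarrow> e s i = e t i) \<Longrightarrow> s = t"
    and "\<And>v. (\<And>i. i < n \<Longrightarrow> v i \<in> R) \<Longrightarrow> (\<Sum>t\<in>T. c t * (\<Prod>i<n. v i ^ e t i)) = 0"
    and "t \<in> T"
  shows "c t = 0"
  using assms
proof (induction n arbitrary: T t)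
  case 0
  then have "T = {t}" by blast
  then show ?case using "0.prems"(4) by simp
next
  case (Suc n)
  define T' where "T' = {s \<in> T. e s n = e t n}"
  show ?case
  proof (rule Suc.IH)
    show "infinite R" using Suc.prems(1) by simp
    show "finite T'" "t \<in> T'" using Suc.prems by (auto simp: T'_def)
    show "s = t" if "s \<in> T'" "t \<in> T'" "\<And>i. i < n \<Longrightarrow> e s i = e t i" for s t
    proof (rule Suc.prems(3))
      show "e s i = e t i" if "i < Suc n" for i
        using that \<open>s \<in> T'\<close> \<open>t \<in> T'\<close> \<open>\<And>i. i < n \<Longrightarrow> e s i = e t i\<close>
        by (cases "i = n") (auto simp: T'_def)
    qed (use that in \<open>auto simp: T'_def\<close>)
    show "(\<Sum>t\<in>T'. c t * (\<Prod>i<n. v i ^ e t i)) = 0" if v: "\<And>i. i < n \<Longrightarrow> v i \<in> R" for v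
    proof -
      define q where "q = (\<Sum>t\<in>T. monom (c t * (\<Prod>i<n. v i ^ e t i)) (e t n))"
      have "poly q a = 0" if "a \<in> R" for a
      proof -
        have "poly q a = (\<Sum>t\<in>T. c t * (\<Prod>i<Suc n. (v(n := a)) i ^ e t i))"
          by (auto simp: q_def poly_sum poly_monom intro!: sum.cong)
        also have "\<dots> = 0"
          by (rule Suc.prems(4)) (use v that in \<open>auto simp: less_Suc_eq\<close>)
        finally show ?thesis .
      qed
      then have "R \<subseteq> {a. poly q a = 0}" by auto
      then have "q = 0"
        using poly_roots_finite[of q] Suc.prems(1) finite_subset by blast
      then have "coeff q (e t n) = 0" by simp
      then show ?thesis
        using Suc.prems(2) by (simp add: q_def coeff_sum T'_def sum.inter_filter)
    qed
  qed
qed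

lemma mpoly_eq_0I:
  fixes p :: "'a::field mpoly"
  assumes "in_vars n p" "n > 0 \<Longrightarrow> infinite R"
    and "\<And>v. (\<And>i. i < n \<Longrightarrow> v i \<in> R) \<Longrightarrow> eval_mpoly id p v = 0"
  shows "p = 0"
proof (rule poly_mapping_eqI)
  fix m
  have "Poly_Mapping.lookup p m = 0" if m: "m \<in> Poly_Mapping.keys p"
  proof (rule monomials_independent[where R = R and n = n and T = "Poly_Mapping.keys p"
        and e = Poly_Mapping.lookup])
    show "s = t" if "s \<in> Poly_Mapping.keys p" "t \<in> Poly_Mapping.keys p"
      "\<And>i. i < n \<Longrightarrow> Poly_Mapping.lookup s i = Poly_Mapping.lookup t i" for s t
    proof (rule poly_mapping_eqI)
      fix i show "Poly_Mapping.lookup s i = Poly_Mapping.lookup t i"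
      proof (cases "i < n")
        case False
        then have "i \<notin> Poly_Mapping.keys s" "i \<notin> Poly_Mapping.keys t"
          using that(1,2) assms(1) by (auto simp: in_vars_def)
        then show ?thesis by (simp add: in_keys_iff)
      qed (use that in simp)
    qed
    show "(\<Sum>t\<in>Poly_Mapping.keys p. Poly_Mapping.lookup p t * (\<Prod>i<n. v i ^ Poly_Mapping.lookup t i)) = 0"
      if "\<And>i. i < n \<Longrightarrow> v i \<in> R" for v
    proof -
      have "eval_mpoly id p v =
          (\<Sum>t\<in>Poly_Mapping.keys p. Poly_Mapping.lookup p t * (\<Prod>i<n. v i ^ Poly_Mapping.lookup t i))"
        unfolding eval_mpoly_alt
        by (intro sum.cong) (use assms(1) in \<open>auto simp: in_vars_def monomial_value_superset[of "{..<n}"]\<close>)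
      then show ?thesis using assms(3)[OF that] by simp
    qed
  qed (use assms(2) m in auto)
  then show "Poly_Mapping.lookup p m = Poly_Mapping.lookup 0 m"
    by (auto simp: in_keys_iff)
qed

section \<open>Rational functions\<close>

text \<open>The extension of an injective ring homomorphism to the field of fractions.\<close>

definition fract_ext :: "('r::idom \<Rightarrow> 'a::field) \<Rightarrow> 'r fract \<Rightarrow> 'a" where
  "fract_ext g z = (SOME w. \<exists>p q. q \<noteq> 0 \<and> z = Fract p q \<and> w = g p / g q)"

lemma fract_ext_Fract:
  assumes "comm_ring_hom g" "\<And>p. g p = 0 \<Longrightarrow> p = 0" "q \<noteq> 0"
  shows "fract_ext g (Fract p q) = g p / g q"
proof -
  interpret comm_ring_hom g by fact
  have "\<exists>p' q'. q' \<noteq> 0 \<and> Fract p q = Fract p' q' \<and> fract_ext g (Fract p q) = g p' / g q'"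
    unfolding fract_ext_def by (rule someI_ex) (use assms(3) in blast)
  then obtain p' q' where *: "q' \<noteq> 0" "Fract p q = Fract p' q'"
    "fract_ext g (Fract p q) = g p' / g q'" by blast
  then have "g (p * q') = g (p' * q)"
    using assms(3) by (simp add: eq_fract)
  moreover have "g q \<noteq> 0" "g q' \<noteq> 0" using assms * by blast+
  ultimately show ?thesis
    unfolding *(3) by (simp add: hom_mult frac_eq_eq)
qed

lemma field_hom_fract_ext:
  assumes "comm_ring_hom g" "\<And>p. g p = 0 \<Longrightarrow> p = 0"
  shows "field_hom (fract_ext g)"
proof -
  interpret comm_ring_hom g by fact
  note ext = fract_ext_Fract[OF assms]
  have ne: "g q \<noteq> 0" if "q \<noteq> 0" for q using assms(2) that by blast
  show ?thesis
  proof unfold_locales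
    show "fract_ext g 0 = 0" "fract_ext g 1 = 1"
      using ext[of 1 0] ext[of 1 1] by (simp_all add: fract_collapse)
    fix x y :: "'a fract"
    obtain a b c d where xy: "x = Fract a b" "b \<noteq> 0" "y = Fract c d" "d \<noteq> 0"
      by (cases x, cases y) blast
    then show "fract_ext g (x + y) = fract_ext g x + fract_ext g y"
      "fract_ext g (x * y) = fract_ext g x * fract_ext g y"
      using ne by (simp_all add: ext hom_add hom_mult field_simps)
  qed
qed

lemma comm_ring_hom_Fract: "comm_ring_hom (\<lambda>p::'a::idom. Fract p 1)"
  by unfold_locales (simp_all add: fract_collapse)

lemma rat_const_eq: "rat_const c = Fract (mconst c) 1"
  by (simp add: rat_const_def mconst_def)

lemma rat_var_eq: "rat_var i = Fract (mvar i) 1"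
  by (simp add: rat_var_def mvar_def)

lemma field_hom_rat_const: "field_hom (rat_const :: 'f::field \<Rightarrow> 'f ratfun)"
proof -
  interpret C: comm_ring_hom "mconst :: 'f \<Rightarrow> _" by (rule comm_ring_hom_mconst)
  interpret F: comm_ring_hom "\<lambda>p::'f mpoly. Fract p 1" by (rule comm_ring_hom_Fract)
  show ?thesis
    by unfold_locales
      (simp_all add: rat_const_eq C.hom_add C.hom_mult fract_collapse)
qed

lemma comm_ring_hom_rat_const: "comm_ring_hom (rat_const :: 'f::field \<Rightarrow> 'f ratfun)"
proof -
  interpret field_hom "rat_const :: 'f \<Rightarrow> 'f ratfun" by (rule field_hom_rat_const)
  show ?thesis by unfold_locales
qed

lemma eval_rat_const_rat_var:
  assumes "h 0 = 0"
  shows "eval_mpoly (\<lambda>c. rat_const (h c)) p rat_var = Fract (eval_mpoly (\<lambda>c. mconst (h c)) p mvar) 1"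
  using hom_eval_mpoly[OF comm_ring_hom_Fract, of "\<lambda>c. mconst (h c)" p mvar]
  by (simp add: rat_const_eq[symmetric] rat_var_eq[symmetric])

lemma Fract_eq_0_iff: "Fract p 1 = 0 \<longleftrightarrow> p = 0" for p :: "'a::idom"
  by (simp add: Zero_fract_def eq_fract)

lemma rat_funsI: "in_vars N p \<Longrightarrow> in_vars N q \<Longrightarrow> q \<noteq> 0 \<Longrightarrow> Fract p q \<in> rat_funs N"
  unfolding rat_funs_def by blast

lemma rat_funsE:
  assumes "z \<in> rat_funs N"
  obtains p q where "z = Fract p q" "in_vars N p" "in_vars N q" "q \<noteq> 0"
  using assms unfolding rat_funs_def by blast

lemma Fract_in_rat_funs: "in_vars N p \<Longrightarrow> Fract p 1 \<in> rat_funs N"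
  using ring_closed_simps(2)[OF ring_closed_in_vars[of N]] by (auto intro: rat_funsI)

lemma field_closed_rat_funs: "field_closed (rat_funs N :: 'f::field ratfun set)"
proof -
  note R = ring_closed_simps[OF ring_closed_in_vars[of N], simplified]
  have 01: "0 \<in> (rat_funs N :: 'f ratfun set)" "1 \<in> (rat_funs N :: 'f ratfun set)"
    unfolding fract_expand by (intro Fract_in_rat_funs R)+
  moreover have "- x \<in> rat_funs N" "inverse x \<in> rat_funs N" if "x \<in> rat_funs N" for x :: "'f ratfun"
  proof -
    obtain p q where x: "x = Fract p q" "in_vars N p" "in_vars N q" "q \<noteq> 0"
      using \<open>x \<in> rat_funs N\<close> by (rule rat_funsE)
    then show "- x \<in> rat_funs N"
      using R(3) by (auto intro: rat_funsI)
    show "inverse x \<in> rat_funs N"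
      using x 01 by (cases "p = 0") (auto simp: fract_collapse intro: rat_funsI)
  qed
  moreover have "x + y \<in> rat_funs N" "x * y \<in> rat_funs N"
    if xy: "x \<in> rat_funs N" "y \<in> rat_funs N" for x y :: "'f ratfun"
  proof -
    obtain p q where x: "x = Fract p q" "in_vars N p" "in_vars N q" "q \<noteq> 0"
      using xy(1) by (rule rat_funsE)
    obtain p' q' where y: "y = Fract p' q'" "in_vars N p'" "in_vars N q'" "q' \<noteq> 0"
      using xy(2) by (rule rat_funsE)
    have "x + y = Fract (p * q' + p' * q) (q * q')" "x * y = Fract (p * p') (q * q')" "q * q' \<noteq> 0"
      using x y by auto
    moreover have "in_vars N (p * q' + p' * q)" "in_vars N (p * p')" "in_vars N (q * q')"
      using x y R by blast+
    ultimately show "x + y \<in> rat_funs N" "x * y \<in> rat_funs N"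
      using rat_funsI by metis+
  qed
  ultimately show ?thesis
    by (simp add: field_closed_def ring_closed_def)
qed

lemma rat_const_in_rat_funs: "rat_const c \<in> rat_funs N"
  by (simp add: rat_const_eq Fract_in_rat_funs in_vars_mconst)

lemma rat_var_in_rat_funs: "i < N \<Longrightarrow> rat_var i \<in> rat_funs N"
  by (simp add: rat_var_eq Fract_in_rat_funs in_vars_mvar)

lemma infinite_rat_funs:
  assumes "n > 0"
  shows "infinite (rat_funs n :: 'f::field ratfun set)"
proof -
  let ?x = "\<lambda>k. Poly_Mapping.single (Poly_Mapping.single 0 k) 1 :: 'f mpoly"
  have "inj (\<lambda>k. Fract (?x k) 1)"
  proof (rule injI)
    fix k k' assume "Fract (?x k) 1 = Fract (?x k') 1"
    then have "?x k = ?x k'" by (simp add: eq_fract)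
    then have "Poly_Mapping.keys (?x k) = Poly_Mapping.keys (?x k')" by simp
    then have "Poly_Mapping.single 0 k = Poly_Mapping.single (0::nat) k'" by simp
    then show "k = k'" by (metis lookup_single_eq)
  qed
  moreover have "range (\<lambda>k. Fract (?x k) 1) \<subseteq> rat_funs n"
    using assms by (auto intro!: Fract_in_rat_funs simp: in_vars_def split: if_splits)
  ultimately show ?thesis
    using range_inj_infinite infinite_super by blast
qed

lemma fract_ext_closed:
  assumes "comm_ring_hom h" "\<And>p. eval_mpoly h p x = 0 \<Longrightarrow> p = 0"
    and "field_closed S" "\<And>c. h c \<in> S" "\<And>i. i < N \<Longrightarrow> x i \<in> S" "z \<in> rat_funs N"
  shows "fract_ext (\<lambda>p. eval_mpoly h p x) z \<in> S"
proof -
  obtain p q where z: "z = Fract p q" "in_vars N p" "in_vars N q" "q \<noteq> 0"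
    using assms(6) by (rule rat_funsE)
  have "eval_mpoly h p x \<in> S" "eval_mpoly h q x \<in> S"
    using z assms field_closedD eval_mpoly_closed by metis+
  then show ?thesis
    using z(1,4) fract_ext_Fract[OF comm_ring_hom_eval_mpoly[OF assms(1)] assms(2)]
    by (simp add: divide_inverse field_closedD[OF assms(3)] ring_closed_simps(5)[OF field_closedD(1)[OF assms(3)]])
qed

lemma fract_ext_eval:
  assumes "comm_ring_hom h" "\<And>p. eval_mpoly h p x = 0 \<Longrightarrow> p = 0"
  shows "fract_ext (\<lambda>p. eval_mpoly h p x) (rat_const c) = h c"
    and "fract_ext (\<lambda>p. eval_mpoly h p x) (rat_var i) = x i"
proof -
  interpret comm_ring_hom h by fact
  interpret e: comm_ring_hom "\<lambda>p. eval_mpoly h p x"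
    by (rule comm_ring_hom_eval_mpoly) fact
  note ext = fract_ext_Fract[OF e.comm_ring_hom_axioms assms(2)]
  show "fract_ext (\<lambda>p. eval_mpoly h p x) (rat_const c) = h c"
    "fract_ext (\<lambda>p. eval_mpoly h p x) (rat_var i) = x i"
    by (simp_all add: rat_const_eq rat_var_eq ext eval_mpoly_mconst eval_mpoly_mvar)
qed

text \<open>Reduces linear independence over a fraction field to independence over the ring.\<close>

lemma common_denominator:
  fixes z :: "nat \<Rightarrow> 'r::idom fract"
  shows "\<exists>q p. q \<noteq> 0 \<and> (\<forall>j<m. z j * Fract q 1 = Fract (p j) 1)"
proof (induction m)
  case 0
  show ?case by (rule exI[of _ 1]) simp
next
  case (Suc m)
  then obtain q p where q: "q \<noteq> 0" "\<And>j. j < m \<Longrightarrow> z j * Fract q 1 = Fract (p j) 1" by blast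
  obtain a b where z: "z m = Fract a b" "b \<noteq> 0" by (cases "z m") blast
  have "z j * Fract (q * b) 1 = Fract (((\<lambda>j. p j * b)(m := a * q)) j) 1" if "j < Suc m" for j
  proof (cases "j = m")
    case True
    then show ?thesis using z by (simp add: eq_fract)
  next
    case False
    then have "z j * Fract q 1 * Fract b 1 = Fract (p j) 1 * Fract b 1"
      using that q(2) by simp
    then show ?thesis using False by (simp add: mult.assoc)
  qed
  moreover have "q * b \<noteq> 0" using q z by simp
  ultimately show ?case by blast
qed


section \<open>Norms through structure constants\<close>

text \<open>A finite extension of \<open>K\<close> inside \<open>L\<close>, given by a basis \<open>a\<close>, the structure constants \<open>\<gamma>\<close> of the
  multiplication and the coordinates \<open>u\<close> of \<open>1\<close>. These are kept as data because \<open>l/k\<close> and the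
  rational functions over \<open>l\<close> and \<open>k\<close> share them, and because it matters later that they lie in small
  subfields of \<open>K\<close>. Elements of the span are handled through coordinate functions, of which only the
  arguments below \<open>m\<close> count.\<close>

locale based_ext = field_hom J for J :: "'K::field \<Rightarrow> 'L::field" +
  fixes m :: nat and a :: "nat \<Rightarrow> 'L" and \<gamma> :: "nat \<Rightarrow> nat \<Rightarrow> nat \<Rightarrow> 'K" and u :: "nat \<Rightarrow> 'K"
  assumes basis_mult: "i < m \<Longrightarrow> j < m \<Longrightarrow> a i * a j = (\<Sum>r<m. J (\<gamma> i j r) * a r)"
    and basis_indep: "(\<Sum>r<m. J (c r) * a r) = 0 \<Longrightarrow> r < m \<Longrightarrow> c r = 0"
    and one_expansion: "(\<Sum>r<m. J (u r) * a r) = 1"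
begin

definition comb :: "(nat \<Rightarrow> 'K) \<Rightarrow> 'L" where
  "comb c = (\<Sum>r<m. J (c r) * a r)"

definition mult_mat :: "(nat \<Rightarrow> 'K) \<Rightarrow> 'K mat" where
  "mult_mat c = mat m m (\<lambda>(i, j). \<Sum>r<m. \<gamma> r j i * c r)"

definition det_norm :: "(nat \<Rightarrow> 'K) \<Rightarrow> 'K" where
  "det_norm c = det (mult_mat c)"

definition combs :: "'K set \<Rightarrow> 'L set" where
  "combs R = comb ` {c. \<forall>r<m. c r \<in> R}"

lemma comb_cong: "(\<And>r. r < m \<Longrightarrow> c r = d r) \<Longrightarrow> comb c = comb d"
  by (simp add: comb_def)

lemma comb_add: "comb (\<lambda>r. c r + d r) = comb c + comb d"
  by (simp add: comb_def hom_add algebra_simps sum.distrib)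

lemma comb_scale: "comb (\<lambda>r. k * c r) = J k * comb c"
  by (simp add: comb_def hom_mult sum_distrib_left algebra_simps)

lemma comb_uminus: "comb (\<lambda>r. - c r) = - comb c"
  using comb_scale[of "-1" c] by (simp add: hom_uminus)

lemma comb_0: "comb (\<lambda>_. 0) = 0"
  by (simp add: comb_def)

lemma comb_sum: "comb (\<lambda>r. \<Sum>j\<in>I. f j r) = (\<Sum>j\<in>I. comb (f j))"
  by (induction I rule: infinite_finite_induct) (simp_all add: comb_0 comb_add)

lemma comb_eqD:
  assumes "comb c = comb d" "r < m"
  shows "c r = d r"
proof -
  have "comb (\<lambda>r. c r + - d r) = 0"
    using assms(1) by (simp only: comb_add comb_uminus) simp
  then have "c r + - d r = 0"
    using basis_indep[of "\<lambda>r. c r + - d r", OF _ assms(2)] by (simp add: comb_def)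
  then show ?thesis by simp
qed

lemma mult_mat_carrier [simp]: "mult_mat c \<in> carrier_mat m m"
  by (simp add: mult_mat_def)

text \<open>The matrix of multiplication: its columns are the coordinates of the multiples of the basis.\<close>

lemma comb_mult_basis:
  assumes "j < m"
  shows "comb c * a j = comb (\<lambda>i. mult_mat c $$ (i, j))"
proof -
  have "comb c * a j = (\<Sum>r<m. J (c r) * (a r * a j))"
    by (simp add: comb_def sum_distrib_right mult.assoc)
  also have "\<dots> = (\<Sum>r<m. \<Sum>i<m. J (\<gamma> r j i * c r) * a i)"
    using assms by (intro sum.cong) (simp_all add: basis_mult sum_distrib_left hom_mult algebra_simps)
  also have "\<dots> = (\<Sum>i<m. \<Sum>r<m. J (\<gamma> r j i * c r) * a i)"
    by (rule sum.swap)
  also have "\<dots> = comb (\<lambda>i. mult_mat c $$ (i, j))"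
    using assms by (simp add: comb_def mult_mat_def hom_sum sum_distrib_right)
  finally show ?thesis .
qed

lemma comb_mult: "comb c * comb d = comb (\<lambda>i. \<Sum>j<m. mult_mat c $$ (i, j) * d j)"
proof -
  have "comb c * comb d = (\<Sum>j<m. J (d j) * (comb c * a j))"
    by (simp add: comb_def[of d] sum_distrib_left algebra_simps)
  also have "\<dots> = comb (\<lambda>i. \<Sum>j<m. d j * mult_mat c $$ (i, j))"
    by (simp add: comb_mult_basis comb_sum comb_scale)
  finally show ?thesis by (simp add: mult.commute)
qed

text \<open>Multiplication matrices multiply like the elements, as coordinates are unique.\<close>

lemma det_norm_mult:
  assumes "comb e = comb c * comb d"
  shows "det_norm e = det_norm c * det_norm d"
proof -
  have "mult_mat e = mult_mat c * mult_mat d"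
  proof (rule eq_matI)
    fix i j assume "i < dim_row (mult_mat c * mult_mat d)" "j < dim_col (mult_mat c * mult_mat d)"
    then have ij: "i < m" "j < m" by (simp_all add: mult_mat_def)
    have "comb (\<lambda>i. mult_mat e $$ (i, j)) = comb c * (comb d * a j)"
      using ij assms by (simp add: comb_mult_basis[symmetric] mult.assoc)
    also have "\<dots> = comb (\<lambda>i. \<Sum>k<m. mult_mat c $$ (i, k) * mult_mat d $$ (k, j))"
      using ij by (simp add: comb_mult_basis comb_mult)
    finally have "mult_mat e $$ (i, j) = (\<Sum>k<m. mult_mat c $$ (i, k) * mult_mat d $$ (k, j))"
      using ij(1) by (rule comb_eqD)
    then show "mult_mat e $$ (i, j) = (mult_mat c * mult_mat d) $$ (i, j)"
      using ij by (simp add: mult_mat_def scalar_prod_def atLeast0LessThan)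
  qed (simp_all add: mult_mat_def)
  then show ?thesis by (simp add: det_norm_def det_mult[of _ m])
qed

lemma det_norm_mult_power:
  assumes "comb e = comb c ^ s * comb d"
  shows "det_norm e = det_norm c ^ s * det_norm d"
  using assms
proof (induction s arbitrary: e)
  case 0
  have unit: "comb u = 1"
    using one_expansion by (simp add: comb_def)
  have "det_norm e = det_norm u * det_norm d"
    using 0 unit by (intro det_norm_mult) simp
  moreover have "det_norm d = det_norm u * det_norm d"
    using unit by (intro det_norm_mult) simp
  ultimately show ?case by (simp only: power_0 mult_1)
next
  case (Suc s)
  (* The induction hypothesis needs coordinates for c^s d; products of combinations have them. *)
  have "\<exists>e'. comb e' = comb c ^ s * comb d"
  proof (induction s)
    case (Suc s)
    then obtain e' where "comb e' = comb c ^ s * comb d" by blast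
    then have "comb c ^ Suc s * comb d = comb c * comb e'" by (simp add: mult.assoc)
    then show ?case by (simp only: comb_mult) blast
  qed auto
  then obtain e' where e': "comb e' = comb c ^ s * comb d" by blast
  then have "det_norm e = det_norm c * det_norm e'"
    using Suc.prems by (intro det_norm_mult) (simp add: mult.assoc)
  then show ?case using Suc.IH[OF e'] by (simp add: mult.assoc)
qed

lemma combsI: "(\<And>r. r < m \<Longrightarrow> c r \<in> R) \<Longrightarrow> comb c \<in> combs R"
  by (auto simp: combs_def)

lemma combsE:
  assumes "z \<in> combs R"
  obtains c where "z = comb c" "\<And>r. r < m \<Longrightarrow> c r \<in> R"
  using assms by (auto simp: combs_def)

text \<open>A domain that is finite-dimensional over a field is a field: a kernel vector of the multiplication
  matrix would be a zero divisor, and Cramer's rule solves the equation for the inverse. The explicit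
  solution shows in which field its coordinates lie.\<close>

lemma comb_inverse:
  assumes "comb c \<noteq> 0"
  shows "det_norm c \<noteq> 0"
    and "comb c * comb (\<lambda>i. inverse (det_norm c) * (\<Sum>j<m. adj_mat (mult_mat c) $$ (i, j) * u j)) = 1"
proof -
  let ?M = "mult_mat c" and ?A = "adj_mat (mult_mat c)"
  have A: "?A \<in> carrier_mat m m" "?M * ?A = det_norm c \<cdot>\<^sub>m 1\<^sub>m m"
    using adj_mat[of ?M m] by (simp_all add: det_norm_def)
  show nz: "det_norm c \<noteq> 0"
  proof
    assume "det_norm c = 0"
    then obtain v where v: "v \<in> carrier_vec m" "v \<noteq> 0\<^sub>v m" "?M *\<^sub>v v = 0\<^sub>v m"
      using det_0_iff_vec_prod_zero_field[of ?M m] by (auto simp: det_norm_def)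
    have "(\<Sum>j<m. ?M $$ (i, j) * v $ j) = 0" if "i < m" for i
    proof -
      have "(?M *\<^sub>v v) $ i = (\<Sum>j<m. ?M $$ (i, j) * v $ j)"
        using that v(1) by (simp add: mult_mat_def scalar_prod_def atLeast0LessThan)
      then show ?thesis using v(3) that by simp
    qed
    then have "comb c * comb (($) v) = comb (\<lambda>_. 0)"
      unfolding comb_mult by (intro comb_cong) simp
    then have "comb (($) v) = comb (\<lambda>_. 0)"
      using assms by (simp add: comb_0)
    then have "v $ i = 0" if "i < m" for i
      using comb_eqD that by blast
    then have "v = 0\<^sub>v m" using v(1) by (intro eq_vecI) auto
    with v(2) show False by simp
  qed
  have MA: "(\<Sum>k<m. ?M $$ (i, k) * ?A $$ (k, j)) = (if i = j then det_norm c else 0)"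
    if "i < m" "j < m" for i j
  proof -
    have "(?M * ?A) $$ (i, j) = (\<Sum>k<m. ?M $$ (i, k) * ?A $$ (k, j))"
      using that A(1) by (simp add: mult_mat_def scalar_prod_def atLeast0LessThan)
    then show ?thesis
      unfolding \<open>(?M * ?A) $$ (i, j) = _\<close>[symmetric] using that by (simp add: A(2))
  qed
  have "(\<Sum>k<m. ?M $$ (i, k) * (inverse (det_norm c) * (\<Sum>j<m. ?A $$ (k, j) * u j))) = u i"
    if "i < m" for i
  proof -
    have "(\<Sum>k<m. ?M $$ (i, k) * (inverse (det_norm c) * (\<Sum>j<m. ?A $$ (k, j) * u j)))
        = (\<Sum>k<m. \<Sum>j<m. inverse (det_norm c) * (?M $$ (i, k) * ?A $$ (k, j)) * u j)"
      by (simp add: sum_distrib_left algebra_simps)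
    also have "\<dots> = (\<Sum>j<m. inverse (det_norm c) * (\<Sum>k<m. ?M $$ (i, k) * ?A $$ (k, j)) * u j)"
      by (subst sum.swap) (simp add: sum_distrib_left sum_distrib_right)
    also have "\<dots> = (\<Sum>j<m. if i = j then u j else 0)"
      using nz that by (intro sum.cong) (simp_all add: MA)
    also have "\<dots> = u i" using that by simp
    finally show ?thesis .
  qed
  then have "comb c * comb (\<lambda>i. inverse (det_norm c) * (\<Sum>j<m. ?A $$ (i, j) * u j)) = comb u"
    unfolding comb_mult by (intro comb_cong) simp
  then show "comb c * comb (\<lambda>i. inverse (det_norm c) * (\<Sum>j<m. ?A $$ (i, j) * u j)) = 1"
    using one_expansion by (simp add: comb_def)
qed

text \<open>In the application \<open>R\<close> is \<open>k(x\<^sub>0, \<dots>, x\<^sub>N\<^sub>-\<^sub>1)\<close>, and \<open>combs R\<close> is \<open>l(x\<^sub>0, \<dots>, x\<^sub>N\<^sub>-\<^sub>1)\<close>.\<close>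

lemma field_closed_combs:
  assumes "field_closed R" "\<And>r j i. \<gamma> r j i \<in> R" "\<And>r. u r \<in> R"
  shows "field_closed (combs R)"
proof -
  note ring = field_closedD(1)[OF assms(1)]
  note R = ring_closed_simps[OF ring] field_closedD(2)[OF assms(1)]
  have M: "mult_mat c $$ (i, j) \<in> R" if "\<And>r. r < m \<Longrightarrow> c r \<in> R" "i < m" "j < m" for c i j
    using that assms(2) by (auto simp: mult_mat_def intro!: ring_closed_sum[OF ring] R)
  have A: "adj_mat (mult_mat c) $$ (i, j) \<in> R" if "\<And>r. r < m \<Longrightarrow> c r \<in> R" "i < m" "j < m" for c i j
  proof -
    have "det (mat_delete (mult_mat c) j i) \<in> R"
    proof (rule ring_closed_det[OF ring])
      show "mat_delete (mult_mat c) j i \<in> carrier_mat (m - 1) (m - 1)"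
        by (rule mat_delete_carrier) simp
      fix p q assume "p < m - 1" "q < m - 1"
      then show "mat_delete (mult_mat c) j i $$ (p, q) \<in> R"
        using that by (auto simp: mat_delete_def mult_mat_carrier[THEN carrier_matD(1)]
            mult_mat_carrier[THEN carrier_matD(2)] intro!: M)
    qed
    then show ?thesis
      using that mult_mat_carrier[of c, THEN carrier_matD(1)] mult_mat_carrier[of c, THEN carrier_matD(2)]
      by (auto simp: adj_mat_def cofactor_def intro!: R ring_closed_power[OF ring])
  qed
  have zero: "0 \<in> combs R" and one: "1 \<in> combs R"
    using combsI[of "\<lambda>_. 0" R] combsI[of u R] R(1) assms(3) one_expansion
    by (simp_all add: comb_0 comb_def)
  have "- x \<in> combs R" "inverse x \<in> combs R" if x: "x \<in> combs R" for x
  proof -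
    obtain c where c: "x = comb c" "\<And>r. r < m \<Longrightarrow> c r \<in> R" using x by (rule combsE) blast
    show "- x \<in> combs R"
      using c combsI[of "\<lambda>r. - c r"] R(3) by (simp add: comb_uminus)
    show "inverse x \<in> combs R"
    proof (cases "x = 0")
      case False
      let ?d = "\<lambda>i. inverse (det_norm c) * (\<Sum>j<m. adj_mat (mult_mat c) $$ (i, j) * u j)"
      have "x * comb ?d = 1" using comb_inverse(2)[of c] False c(1) by simp
      then have "inverse x = comb ?d" by (rule inverse_unique)
      moreover have "det_norm c \<in> R"
        unfolding det_norm_def using c(2) M by (intro ring_closed_det[OF ring mult_mat_carrier]) auto
      ultimately show ?thesis
        using c(2) A assms(3) by (auto intro!: combsI R ring_closed_sum[OF ring])
    qed (use zero in simp)
  qed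
  moreover have "x + y \<in> combs R" "x * y \<in> combs R" if xy: "x \<in> combs R" "y \<in> combs R" for x y
  proof -
    obtain c where c: "x = comb c" "\<And>r. r < m \<Longrightarrow> c r \<in> R" using xy(1) by (rule combsE) blast
    obtain d where d: "y = comb d" "\<And>r. r < m \<Longrightarrow> d r \<in> R" using xy(2) by (rule combsE) blast
    show "x + y \<in> combs R"
      using c d by (auto simp: comb_add[symmetric] intro!: combsI R)
    show "x * y \<in> combs R"
      using c d by (auto simp: comb_mult intro!: combsI R ring_closed_sum[OF ring] M)
  qed
  ultimately show ?thesis
    using zero one by (simp add: field_closed_def ring_closed_def)
qed

end


section \<open>Coordinates and restriction of scalars\<close>

context vector_space
begin

lemma sum_set_nth:
  fixes f :: "'b \<Rightarrow> 'c::comm_monoid_add"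
  assumes "distinct bs"
  shows "(\<Sum>b\<in>set bs. f b) = (\<Sum>i<length bs. f (bs ! i))"
  using sum.reindex_bij_betw[OF bij_betw_nth[OF assms refl refl], of f] by simp

lemma ordered_basis_indep:
  assumes "ordered_basis scale bs" "(\<Sum>i<length bs. scale (c i) (bs ! i)) = 0" "i < length bs"
  shows "c i = 0"
proof -
  have d: "distinct bs" and indep: "independent (set bs)"
    using assms(1) by (auto simp: ordered_basis_def)
  define g where "g b = c (the_inv_into {..<length bs} ((!) bs) b)" for b
  have inj: "inj_on ((!) bs) {..<length bs}"
    using d by (simp add: inj_on_nth)
  have g: "g (bs ! j) = c j" if "j < length bs" for j
    using the_inv_into_f_f[OF inj] that by (simp add: g_def)
  have "(\<Sum>b\<in>set bs. scale (g b) b) = 0"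
    using assms(2) by (simp add: sum_set_nth[OF d] g)
  then have "g (bs ! i) = 0"
    using independentD[OF indep, of "set bs" g "bs ! i"] assms(3) by simp
  then show ?thesis using g assms(3) by simp
qed

lemma ordered_basis_sum_coord:
  assumes "ordered_basis scale bs"
  shows "(\<Sum>i<length bs. scale (coord scale bs v i) (bs ! i)) = v"
  using assms sum_representation_eq[of "set bs" v "set bs"]
  by (simp add: ordered_basis_def coord_def sum_set_nth)

lemma coord_unique:
  assumes "ordered_basis scale bs" "v = (\<Sum>i<length bs. scale (c i) (bs ! i))" "i < length bs"
  shows "coord scale bs v i = c i"
proof -
  have "(\<Sum>i<length bs. scale (coord scale bs v i - c i) (bs ! i)) = 0"
    using ordered_basis_sum_coord[OF assms(1), of v] assms(2)
    by (simp add: scale_left_diff_distrib sum_subtractf)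
  then have "coord scale bs v i - c i = 0"
    by (rule ordered_basis_indep[OF assms(1) _ assms(3)])
  then show ?thesis by simp
qed

lemma ordered_basisI:
  assumes indep: "\<And>c i. (\<Sum>i<length bs. scale (c i) (bs ! i)) = 0 \<Longrightarrow> i < length bs \<Longrightarrow> c i = 0"
    and gen: "\<And>v. \<exists>c. v = (\<Sum>i<length bs. scale (c i) (bs ! i))"
  shows "ordered_basis scale bs"
proof -
  have d: "distinct bs"
    unfolding distinct_conv_nth
  proof (intro allI impI notI)
    fix i j assume ij: "i < length bs" "j < length bs" "i \<noteq> j" "bs ! i = bs ! j"
    let ?c = "\<lambda>k. (if k = i then 1 else 0) - (if k = j then 1 else 0) :: 'a"
    have delta: "(\<Sum>k<length bs. scale (if k = l then 1 else 0) (bs ! k)) = bs ! l" if "l < length bs" for l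
    proof -
      have "(\<Sum>k<length bs. scale (if k = l then 1 else 0) (bs ! k)) = (\<Sum>k<length bs. if k = l then bs ! k else 0)"
        by (intro sum.cong) auto
      then show ?thesis using that by simp
    qed
    have "(\<Sum>k<length bs. scale (?c k) (bs ! k)) = 0"
      using ij by (simp only: scale_left_diff_distrib sum_subtractf delta) simp
    from indep[OF this ij(1)] have "?c i = 0" .
    then show False using ij(3) by simp
  qed
  moreover have "independent (set bs)"
  proof
    assume "dependent (set bs)"
    then obtain g where g: "\<exists>v\<in>set bs. g v \<noteq> 0" "(\<Sum>v\<in>set bs. scale (g v) v) = 0"
      by (auto simp: dependent_finite)
    then have "g (bs ! i) = 0" if "i < length bs" for i
      using indep[of "\<lambda>i. g (bs ! i)"] that by (simp add: sum_set_nth[OF d])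
    then show False using g(1) by (auto simp: in_set_conv_nth)
  qed
  moreover have "v \<in> span (set bs)" for v
  proof -
    obtain c where v: "v = (\<Sum>i<length bs. scale (c i) (bs ! i))" using gen by blast
    show ?thesis unfolding v by (intro span_sum span_scale span_base) simp
  qed
  ultimately show ?thesis by (auto simp: ordered_basis_def)
qed

end

lemma sum_lessThan_add:
  fixes f :: "nat \<Rightarrow> 'a::comm_monoid_add"
  shows "(\<Sum>s<p + q. f s) = (\<Sum>s<p. f s) + (\<Sum>j<q. f (p + j))"
  by (induction q) (simp_all add: add.assoc)

lemma sum_lessThan_mult:
  fixes f :: "nat \<Rightarrow> 'a::comm_monoid_add"
  shows "(\<Sum>s<n * m. f s) = (\<Sum>i<n. \<Sum>j<m. f (i * m + j))"
proof (induction n)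
  case (Suc n)
  have "(\<Sum>s<Suc n * m. f s) = (\<Sum>s<n * m + m. f s)" by (simp add: add.commute)
  then show ?case by (simp add: sum_lessThan_add Suc)
qed simp

lemma index_lt:
  fixes i j n m :: nat
  assumes "i < n" "j < m"
  shows "i * m + j < n * m"
proof -
  have "i * m + j < Suc i * m" using assms by simp
  also have "\<dots> \<le> n * m" using assms by (intro mult_le_mono1) simp
  finally show ?thesis .
qed

lemma div_mult_self_add: "j < m \<Longrightarrow> (i * m + j) div m = i" for i j m :: nat
  by (subst add.commute) simp

lemma vector_space_restrict_scale:
  assumes "field_hom \<iota>" "vector_space scale"
  shows "vector_space (restrict_scale \<iota> scale)"
proof -
  interpret field_hom \<iota> by fact
  interpret vector_space scale by fact
  show ?thesis
    by unfold_locales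
      (simp_all add: restrict_scale_def hom_add hom_mult scale_right_distrib scale_left_distrib)
qed

text \<open>The product basis, ordered such that the \<open>i\<close>-th coordinate over \<open>l\<close> becomes the \<open>i\<close>-th block of
  \<open>length as\<close> consecutive coordinates over \<open>k\<close>.\<close>

definition tower_basis :: "('l \<Rightarrow> 'v \<Rightarrow> 'v) \<Rightarrow> 'l list \<Rightarrow> 'v list \<Rightarrow> 'v list" where
  "tower_basis scale as es = map (\<lambda>s. scale (as ! (s mod length as)) (es ! (s div length as))) [0..<length es * length as]"

lemma length_tower_basis [simp]: "length (tower_basis scale as es) = length es * length as"
  by (simp add: tower_basis_def)

lemma tower_basis_nth:
  assumes "i < length es" "j < length as"
  shows "tower_basis scale as es ! (i * length as + j) = scale (as ! j) (es ! i)"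
  using index_lt[OF assms] assms(2) by (simp add: tower_basis_def div_mult_self_add)

lemma
  fixes scale :: "'l::field \<Rightarrow> 'v::ab_group_add \<Rightarrow> 'v"
  assumes hom: "field_hom \<iota>" and vs: "vector_space scale"
    and as: "ordered_basis (ext_scale \<iota>) as" and es: "ordered_basis scale es"
  shows ordered_basis_tower: "ordered_basis (restrict_scale \<iota> scale) (tower_basis scale as es)"
    and coord_tower: "i < length es \<Longrightarrow> j < length as \<Longrightarrow>
      coord (restrict_scale \<iota> scale) (tower_basis scale as es) v (i * length as + j) =
      coord (ext_scale \<iota>) as (coord scale es v i) j"
proof -
  interpret field_hom \<iota> by fact
  interpret V: vector_space scale by fact
  have "vector_space ((*) :: 'l \<Rightarrow> 'l \<Rightarrow> 'l)"
    by unfold_locales (simp_all add: algebra_simps)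
  then interpret L: vector_space "ext_scale \<iota>"
    by (rule vector_space_restrict_scale[OF hom])
  interpret W: vector_space "restrict_scale \<iota> scale"
    by (rule vector_space_restrict_scale[OF hom vs])
  let ?m = "length as" and ?n = "length es" and ?bs = "tower_basis scale as es"
  have expand: "(\<Sum>s<length ?bs. restrict_scale \<iota> scale (c s) (?bs ! s)) =
      (\<Sum>i<?n. scale (\<Sum>j<?m. ext_scale \<iota> (c (i * ?m + j)) (as ! j)) (es ! i))" for c
    by (simp add: sum_lessThan_mult tower_basis_nth restrict_scale_def V.scale_sum_left)
  define cc where "cc v s = coord (ext_scale \<iota>) as (coord scale es v (s div ?m)) (s mod ?m)" for v s
  have cc: "cc v (i * ?m + j) = coord (ext_scale \<iota>) as (coord scale es v i) j" if "j < ?m" for v i j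
    using that by (simp add: cc_def div_mult_self_add)
  have repr: "v = (\<Sum>s<length ?bs. restrict_scale \<iota> scale (cc v s) (?bs ! s))" for v
    unfolding expand by (simp add: cc L.ordered_basis_sum_coord[OF as] V.ordered_basis_sum_coord[OF es])
  show basis: "ordered_basis (restrict_scale \<iota> scale) ?bs"
  proof (rule W.ordered_basisI)
    fix c s assume c: "(\<Sum>s<length ?bs. restrict_scale \<iota> scale (c s) (?bs ! s)) = 0" and s: "s < length ?bs"
    then have m: "0 < ?m" by (cases "?m = 0") auto
    then have ij: "s div ?m < ?n" "s mod ?m < ?m"
      using s by (simp_all add: less_mult_imp_div_less)
    have "(\<Sum>j<?m. ext_scale \<iota> (c (s div ?m * ?m + j)) (as ! j)) = 0"
      by (rule V.ordered_basis_indep[OF es c[unfolded expand] ij(1)])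
    then have "c (s div ?m * ?m + s mod ?m) = 0"
      by (rule L.ordered_basis_indep[OF as _ ij(2)])
    then show "c s = 0" by simp
  qed (use repr in blast)
  show "coord (restrict_scale \<iota> scale) ?bs v (i * ?m + j) = coord (ext_scale \<iota>) as (coord scale es v i) j"
    if "i < ?n" "j < ?m"
    using W.coord_unique[OF basis repr] index_lt[OF that] that by (simp add: cc)
qed

lemma finite_ext_basis_exists:
  assumes "finite_ext \<iota>"
  shows "\<exists>as. ordered_basis (ext_scale \<iota>) as"
proof -
  obtain B where "finite_dimensional_vector_space (ext_scale \<iota>) B"
    using assms by (auto simp: finite_ext_def)
  then interpret finite_dimensional_vector_space "ext_scale \<iota>" B .
  obtain as where "set as = B" "distinct as"
    using finite_distinct_list[OF finite_Basis] by blast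
  then show ?thesis
    using independent_Basis span_Basis by (auto simp: ordered_basis_def)
qed

lemma length_ext_basis:
  assumes "finite_ext \<iota>" "ordered_basis (ext_scale \<iota>) as"
  shows "length as = ext_degree \<iota>"
proof -
  obtain B where "finite_dimensional_vector_space (ext_scale \<iota>) B"
    using assms by (auto simp: finite_ext_def)
  then interpret finite_dimensional_vector_space "ext_scale \<iota>" B .
  show ?thesis
    using assms(2) dim_eq_card[of "set as" UNIV]
    by (simp add: ordered_basis_def ext_degree_def distinct_card)
qed


section \<open>The norm of a polynomial\<close>

locale ext_basis = field_hom \<iota> for \<iota> :: "'k::field \<Rightarrow> 'l::field" +
  fixes as :: "'l list"
  assumes basis: "ordered_basis (ext_scale \<iota>) as"
begin

sublocale L: vector_space "ext_scale \<iota>"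
proof -
  have "vector_space ((*) :: 'l \<Rightarrow> 'l \<Rightarrow> 'l)"
    by unfold_locales (simp_all add: algebra_simps)
  then show "vector_space (ext_scale \<iota>)"
    by (rule vector_space_restrict_scale[OF field_hom_axioms])
qed

abbreviation m :: nat where "m \<equiv> length as"

abbreviation cf :: "'l \<Rightarrow> nat \<Rightarrow> 'k" where "cf \<equiv> coord (ext_scale \<iota>) as"

definition struct_const :: "nat \<Rightarrow> nat \<Rightarrow> nat \<Rightarrow> 'k" where
  "struct_const i j = cf (as ! i * as ! j)"

lemma cf_sum: "(\<Sum>r<m. \<iota> (cf x r) * as ! r) = x"
  using L.ordered_basis_sum_coord[OF basis, of x] by (simp add: restrict_scale_def)

lemma cf_0: "cf 0 r = 0"
  using basis by (simp add: coord_def ordered_basis_def L.representation_zero)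

sublocale base: based_ext \<iota> m "\<lambda>j. as ! j" struct_const "cf 1"
proof unfold_locales
  show "c r = 0" if "(\<Sum>r<m. \<iota> (c r) * as ! r) = 0" "r < m" for c r
    using L.ordered_basis_indep[OF basis, of c r] that by (simp add: restrict_scale_def)
qed (simp_all add: struct_const_def cf_sum)

lemma degree_pos: "m > 0"
  using base.one_expansion by (cases "m = 0") auto

lemma basis_nonzero: "as ! 0 \<noteq> 0"
proof
  assume *: "as ! 0 = 0"
  have "(\<Sum>r<m. \<iota> (if r = 0 then 1 else 0) * as ! r) = 0"
    using * by (intro sum.neutral) auto
  from base.basis_indep[OF this degree_pos] show False by simp
qed

lemma base_comb_cf: "base.comb (cf x) = x"
  by (simp add: base.comb_def cf_sum)

text \<open>The norm of \<open>l/k\<close> is defined by a chosen basis, so \<open>as\<close> is taken to be that one.\<close>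

lemma field_norm_eq_det_norm:
  assumes "as = (SOME as. ordered_basis (ext_scale \<iota>) as)"
  shows "field_norm \<iota> x = base.det_norm (cf x)"
proof -
  have "cf (x * as ! j) i = base.mult_mat (cf x) $$ (i, j)" if "i < m" "j < m" for i j
    by (rule base.comb_eqD[OF _ that(1)])
      (simp add: base_comb_cf base.comb_mult_basis[OF that(2), symmetric])
  then have "mat m m (\<lambda>(i, j). cf (x * as ! j) i) = base.mult_mat (cf x)"
    by (intro eq_matI) (simp_all add: base.mult_mat_def)
  then show ?thesis
    unfolding field_norm_def base.det_norm_def assms[symmetric] Let_def by simp
qed

text \<open>A relation between the \<open>a\<^sub>r\<close> with coefficients in \<open>k[X]\<close> is one with coefficients in \<open>k\<close> for each
  monomial.\<close>

lemma mconst_map_indep: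
  assumes "(\<Sum>r<m. mconst (as ! r) * eval_mpoly (\<lambda>c. mconst (\<iota> c)) (p r) mvar) = 0" "r < m"
  shows "p r = 0"
proof (rule poly_mapping_eqI)
  fix k
  have "(\<Sum>r<m. \<iota> (Poly_Mapping.lookup (p r) k) * as ! r) =
      Poly_Mapping.lookup (\<Sum>r<m. mconst (as ! r) * eval_mpoly (\<lambda>c. mconst (\<iota> c)) (p r) mvar) k"
    by (simp add: lookup_sum lookup_mconst_mult lookup_eval_mconst_mvar mult.commute)
  also have "\<dots> = 0" by (simp add: assms(1))
  finally show "Poly_Mapping.lookup (p r) k = Poly_Mapping.lookup 0 k"
    using base.basis_indep[of "\<lambda>r. Poly_Mapping.lookup (p r) k"] assms(2) by simp
qed

text \<open>The embedding of \<open>k(X)\<close> into \<open>l(X)\<close>.\<close>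

definition lift :: "'k ratfun \<Rightarrow> 'l ratfun" where
  "lift = fract_ext (\<lambda>p. eval_mpoly (\<lambda>c. rat_const (\<iota> c)) p rat_var)"

lemma comm_ring_hom_const_map: "comm_ring_hom (\<lambda>c. rat_const (\<iota> c))"
proof -
  interpret c: comm_ring_hom "rat_const :: 'l \<Rightarrow> _" by (rule comm_ring_hom_rat_const)
  show ?thesis by unfold_locales (simp_all add: c.hom_add c.hom_mult hom_add hom_mult)
qed

lemma eval_const_map: "eval_mpoly (\<lambda>c. rat_const (\<iota> c)) p rat_var =
    Fract (eval_mpoly (\<lambda>c. mconst (\<iota> c)) p mvar) 1"
  by (rule eval_rat_const_rat_var) simp

lemma eval_const_map_eq_0D:
  assumes "eval_mpoly (\<lambda>c. rat_const (\<iota> c)) p rat_var = 0"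
  shows "p = 0"
proof (rule poly_mapping_eqI)
  fix k
  have "eval_mpoly (\<lambda>c. mconst (\<iota> c)) p mvar = 0"
    using assms by (simp add: eval_const_map Fract_eq_0_iff)
  then have "\<iota> (Poly_Mapping.lookup p k) = 0"
    using lookup_eval_mconst_mvar[of \<iota> p k] by simp
  then show "Poly_Mapping.lookup p k = Poly_Mapping.lookup 0 k" by simp
qed

lemma field_hom_lift: "field_hom lift"
  unfolding lift_def
  by (rule field_hom_fract_ext[OF comm_ring_hom_eval_mpoly[OF comm_ring_hom_const_map]
        eval_const_map_eq_0D])

lemma lift_const: "lift (rat_const c) = rat_const (\<iota> c)"
  and lift_var: "lift (rat_var i) = rat_var i"
  unfolding lift_def by (rule fract_ext_eval[OF comm_ring_hom_const_map eval_const_map_eq_0D]; simp)+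

lemma lift_Fract: "lift (Fract p 1) = Fract (eval_mpoly (\<lambda>c. mconst (\<iota> c)) p mvar) 1"
proof -
  interpret e: comm_ring_hom "\<lambda>p. eval_mpoly (\<lambda>c. rat_const (\<iota> c)) p (rat_var :: nat \<Rightarrow> 'l ratfun)"
    by (rule comm_ring_hom_eval_mpoly[OF comm_ring_hom_const_map])
  have "lift (Fract p 1) = eval_mpoly (\<lambda>c. rat_const (\<iota> c)) p rat_var"
    using fract_ext_Fract[OF e.comm_ring_hom_axioms eval_const_map_eq_0D, of 1 p]
    by (simp add: lift_def)
  then show ?thesis by (simp only: eval_const_map)
qed

text \<open>The basis of \<open>l/k\<close> remains one after adjoining the variables. Independence holds for polynomial
  coefficients by \<open>mconst_map_indep\<close>, hence for all after clearing denominators.\<close>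

sublocale gen: based_ext lift m "\<lambda>j. rat_const (as ! j)" "\<lambda>i j r. rat_const (struct_const i j r)"
  "\<lambda>r. rat_const (cf 1 r)"
proof -
  interpret lift: field_hom lift by (rule field_hom_lift)
  interpret c: comm_ring_hom "rat_const :: 'l \<Rightarrow> _" by (rule comm_ring_hom_rat_const)
  interpret F: comm_ring_hom "\<lambda>p::'l mpoly. Fract p 1" by (rule comm_ring_hom_Fract)
  show "based_ext lift m (\<lambda>j. rat_const (as ! j)) (\<lambda>i j r. rat_const (struct_const i j r))
    (\<lambda>r. rat_const (cf 1 r))"
  proof unfold_locales
    show "rat_const (as ! i) * rat_const (as ! j) =
        (\<Sum>r<m. lift (rat_const (struct_const i j r)) * rat_const (as ! r))" if "i < m" "j < m" for i j
      using base.basis_mult[OF that]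
      by (simp add: lift_const c.hom_mult[symmetric] c.hom_sum[symmetric])
    show "(\<Sum>r<m. lift (rat_const (cf 1 r)) * rat_const (as ! r)) = 1"
      using base.one_expansion
      by (simp add: lift_const c.hom_mult[symmetric] c.hom_sum[symmetric])
    fix c r assume c: "(\<Sum>r<m. lift (c r) * rat_const (as ! r)) = 0" and r: "r < m"
    obtain q p where q: "q \<noteq> 0" and p: "\<And>r. r < m \<Longrightarrow> c r * Fract q 1 = Fract (p r) 1"
      using common_denominator[of m c] by blast
    have "Fract (\<Sum>r<m. mconst (as ! r) * eval_mpoly (\<lambda>c. mconst (\<iota> c)) (p r) mvar) 1 =
        (\<Sum>r<m. rat_const (as ! r) * lift (Fract (p r) 1))"
      by (simp only: F.hom_sum F.hom_mult rat_const_eq lift_Fract)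
    also have "\<dots> = (\<Sum>r<m. lift (c r) * rat_const (as ! r)) * lift (Fract q 1)"
      by (simp add: p[symmetric] lift.hom_mult sum_distrib_left algebra_simps)
    also have "\<dots> = 0" by (simp add: c)
    finally have "(\<Sum>r<m. mconst (as ! r) * eval_mpoly (\<lambda>c. mconst (\<iota> c)) (p r) mvar) = 0"
      by (simp only: Fract_eq_0_iff)
    from mconst_map_indep[OF this r] have "c r * Fract q 1 = 0"
      using p[OF r] by (simp add: fract_collapse)
    then show "c r = 0" using q by (simp add: Fract_eq_0_iff)
  qed
qed

text \<open>The generic element of \<open>l\<close>, in the \<open>i\<close>-th block of variables.\<close>

definition generic_elt :: "nat \<Rightarrow> 'l mpoly" where
  "generic_elt i = (\<Sum>j<m. mconst (as ! j) * mvar (i * m + j))"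

definition expand :: "'l mpoly \<Rightarrow> 'l mpoly" where
  "expand p = eval_mpoly mconst p generic_elt"

text \<open>The polynomials over \<open>k\<close> with \<open>expand p = \<Sum>\<^sub>r a\<^sub>r component p r\<close>.\<close>

definition component :: "'l mpoly \<Rightarrow> nat \<Rightarrow> 'k mpoly" where
  "component p r = Poly_Mapping.map (\<lambda>x. cf x r) (expand p)"

text \<open>The norm of \<open>expand p\<close>: the multiplication matrix, with the components as coordinates.\<close>

definition norm_poly :: "'l mpoly \<Rightarrow> 'k mpoly" where
  "norm_poly p = det (mat m m (\<lambda>(i, j). \<Sum>r<m. mconst (struct_const r j i) * component p r))"

lemma lookup_component: "Poly_Mapping.lookup (component p r) k = cf (Poly_Mapping.lookup (expand p) k) r"
  by (simp add: component_def map.rep_eq when_def cf_0)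

lemma keys_component: "Poly_Mapping.keys (component p r) \<subseteq> Poly_Mapping.keys (expand p)"
  by (auto simp: in_keys_iff lookup_component cf_0)

lemma eval_generic_elt:
  assumes "comm_ring_hom h"
  shows "eval_mpoly h (generic_elt i) y = (\<Sum>j<m. h (as ! j) * y (i * m + j))"
proof -
  interpret h: comm_ring_hom h by fact
  interpret e: comm_ring_hom "\<lambda>p. eval_mpoly h p y" by (rule comm_ring_hom_eval_mpoly) fact
  show ?thesis
    by (simp add: generic_elt_def e.hom_sum e.hom_mult eval_mpoly_mconst eval_mpoly_mvar)
qed

lemma eval_expand:
  assumes "comm_ring_hom h"
  shows "eval_mpoly h (expand p) y = eval_mpoly h p (\<lambda>i. \<Sum>j<m. h (as ! j) * y (i * m + j))"
proof -
  interpret h: comm_ring_hom h by fact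
  show ?thesis
    unfolding expand_def
    by (subst hom_eval_mpoly[OF comm_ring_hom_eval_mpoly[OF assms]])
      (simp add: eval_generic_elt[OF assms] eval_mpoly_mconst)
qed

text \<open>The substitution \<open>x\<^sub>i \<mapsto> \<Sum>\<^sub>j a\<^sub>j x\<^sub>i\<^sub>j\<close> has a left inverse, given by \<open>x\<^sub>i\<^sub>0 \<mapsto> a\<^sub>0\<^sup>-\<^sup>1 x\<^sub>i\<close> and \<open>x\<^sub>i\<^sub>j \<mapsto> 0\<close> for
  \<open>j > 0\<close>.\<close>

lemma expand_eq_0D:
  assumes "expand p = 0"
  shows "p = 0"
proof -
  define y :: "nat \<Rightarrow> 'l mpoly" where
    "y s = (if s mod m = 0 then mconst (inverse (as ! 0)) * mvar (s div m) else 0)" for s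
  interpret C: comm_ring_hom "mconst :: 'l \<Rightarrow> _" by (rule comm_ring_hom_mconst)
  have "(\<Sum>j<m. mconst (as ! j) * y (i * m + j)) = mvar i" for i
  proof -
    have "(\<Sum>j<m. mconst (as ! j) * y (i * m + j)) =
        (\<Sum>j<m. if j = 0 then mconst (as ! 0 * inverse (as ! 0)) * mvar i else 0)"
      by (intro sum.cong) (auto simp: y_def C.hom_mult div_mult_self_add mult.assoc)
    then show ?thesis
      using basis_nonzero degree_pos by simp
  qed
  then have "eval_mpoly mconst (expand p) y = p"
    by (simp add: eval_expand[OF comm_ring_hom_mconst] eval_mpoly_mconst_mvar)
  then show ?thesis using assms by (simp add: eval_mpoly_alt)
qed

lemma in_vars_generic_elt:
  assumes "i < n"
  shows "in_vars (n * m) (generic_elt i)"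
proof -
  note R = ring_closed_in_vars[of "n * m"]
  have "generic_elt i \<in> {p. in_vars (n * m) p}"
    unfolding generic_elt_def using assms
    by (intro ring_closed_sum[OF R] ring_closed_simps(5)[OF R])
      (simp_all add: in_vars_mconst in_vars_mvar index_lt)
  then show ?thesis by simp
qed

lemma homogeneous_generic_elt: "homogeneous 1 (generic_elt i)"
  unfolding generic_elt_def by (intro homogeneous_sum homogeneous_mconst_mult homogeneous_mvar)

lemma in_vars_norm_poly:
  assumes "in_vars n p"
  shows "in_vars (n * m) (norm_poly p)"
proof -
  note R = ring_closed_in_vars[of "n * m"]
  have "expand p \<in> {q. in_vars (n * m) q}"
    unfolding expand_def
    by (rule eval_mpoly_closed[OF R assms]) (simp_all add: in_vars_mconst in_vars_generic_elt)
  then have "in_vars (n * m) (component p r)" for r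
    using keys_component[of p r] by (auto simp: in_vars_def)
  then have "norm_poly p \<in> {q. in_vars (n * m) q}"
    unfolding norm_poly_def
    by (intro ring_closed_det[OF R]) (auto intro!: ring_closed_sum[OF R, simplified]
      ring_closed_simps(5)[OF R, simplified] in_vars_mconst)
  then show ?thesis by simp
qed

lemma homogeneous_norm_poly:
  assumes "homogeneous d p"
  shows "homogeneous (m * d) (norm_poly p)"
proof -
  have "homogeneous d (expand p)"
    unfolding expand_def using homogeneous_eval_mpoly[OF assms homogeneous_generic_elt, of "\<lambda>c. c"] by simp
  then have "homogeneous d (component p r)" for r
    using keys_component[of p r] by (auto simp: homogeneous_def)
  then show ?thesis
    unfolding norm_poly_def
    by (intro homogeneous_det) (auto intro!: homogeneous_sum homogeneous_mconst_mult)
qed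

text \<open>The link between \<open>p\<close> and its norm polynomial, for values in any extension \<open>L/K\<close> that has the basis
  and the structure constants of \<open>l/k\<close>: values of \<open>norm_poly p\<close> are norms of values of \<open>p\<close>. It is used
  for \<open>l/k\<close>, to describe the form \<open>\<phi>\<close>, and for rational functions.\<close>

lemma
  fixes J' :: "'K::field \<Rightarrow> 'L::field"
  assumes "based_ext J' m (\<lambda>j. hl (as ! j)) (\<lambda>i j r. hk (struct_const i j r)) u'"
    and "comm_ring_hom hk" "comm_ring_hom hl" "\<And>c. J' (hk c) = hl (\<iota> c)"
  shows comb_eval_component:
      "based_ext.comb J' m (\<lambda>j. hl (as ! j)) (\<lambda>r. eval_mpoly hk (component p r) x) =
        eval_mpoly hl p (\<lambda>i. based_ext.comb J' m (\<lambda>j. hl (as ! j)) (\<lambda>j. x (i * m + j)))"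
    and eval_norm_poly:
      "eval_mpoly hk (norm_poly p) x =
        based_ext.det_norm m (\<lambda>i j r. hk (struct_const i j r)) (\<lambda>r. eval_mpoly hk (component p r) x)"
proof -
  interpret E: based_ext J' m "\<lambda>j. hl (as ! j)" "\<lambda>i j r. hk (struct_const i j r)" u' by fact
  interpret hk: comm_ring_hom hk by fact
  interpret hl: comm_ring_hom hl by fact
  let ?K = "Poly_Mapping.keys (expand p)"
  have "E.comb (\<lambda>r. eval_mpoly hk (component p r) x) =
      (\<Sum>r<m. \<Sum>k\<in>?K. J' (hk (cf (Poly_Mapping.lookup (expand p) k) r)) *
        monomial_value (\<lambda>s. J' (x s)) k * hl (as ! r))"
    unfolding E.comb_def
    by (simp add: eval_mpoly_superset[of hk ?K, OF hk.hom_zero finite_keys keys_component] lookup_component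
        E.hom_sum E.hom_mult hom_monomial_value[OF E.comm_ring_hom_axioms] sum_distrib_right)
  also have "\<dots> = (\<Sum>k\<in>?K. \<Sum>r<m. J' (hk (cf (Poly_Mapping.lookup (expand p) k) r)) *
        monomial_value (\<lambda>s. J' (x s)) k * hl (as ! r))"
    by (rule sum.swap)
  also have "\<dots> = (\<Sum>k\<in>?K. hl (\<Sum>r<m. \<iota> (cf (Poly_Mapping.lookup (expand p) k) r) * as ! r) *
        monomial_value (\<lambda>s. J' (x s)) k)"
    by (simp add: assms(4) hl.hom_sum hl.hom_mult sum_distrib_left algebra_simps)
  also have "\<dots> = eval_mpoly hl (expand p) (\<lambda>s. J' (x s))"
    by (simp add: cf_sum eval_mpoly_alt)
  also have "\<dots> = eval_mpoly hl p (\<lambda>i. E.comb (\<lambda>j. x (i * m + j)))"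
    by (simp add: eval_expand[OF assms(3)] E.comb_def mult.commute)
  finally show "E.comb (\<lambda>r. eval_mpoly hk (component p r) x) =
      eval_mpoly hl p (\<lambda>i. E.comb (\<lambda>j. x (i * m + j)))" .
  interpret e: comm_ring_hom "\<lambda>p. eval_mpoly hk p x"
    by (rule comm_ring_hom_eval_mpoly) fact
  have "map_mat (\<lambda>p. eval_mpoly hk p x) (mat m m (\<lambda>(i, j). \<Sum>r<m. mconst (struct_const r j i) * component p r))
      = E.mult_mat (\<lambda>r. eval_mpoly hk (component p r) x)"
    by (rule eq_matI) (simp_all add: E.mult_mat_def e.hom_sum e.hom_mult eval_mpoly_mconst)
  then show "eval_mpoly hk (norm_poly p) x = E.det_norm (\<lambda>r. eval_mpoly hk (component p r) x)"
    unfolding norm_poly_def E.det_norm_def e.hom_det[symmetric] by simp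
qed

lemma coord_poly_norm_poly:
  assumes vs: "vector_space scale" and p: "coord_poly scale es d \<phi> p"
    and as: "as = (SOME as. ordered_basis (ext_scale \<iota>) as)"
  shows "coord_poly (restrict_scale \<iota> scale) (tower_basis scale as es) (m * d)
    (\<lambda>v. field_norm \<iota> (\<phi> v)) (norm_poly p)"
proof -
  have es: "ordered_basis scale es" and vars: "in_vars (length es) p" and hom: "homogeneous d p"
    and val: "\<And>v. \<phi> v = eval_mpoly id p (coord scale es v)"
    using p by (auto simp: coord_poly_def)
  have id: "comm_ring_hom (id :: 'f::comm_ring_1 \<Rightarrow> 'f)"
    by unfold_locales simp_all
  have E: "based_ext \<iota> m (\<lambda>j. id (as ! j)) (\<lambda>i j r. id (struct_const i j r)) (cf 1)"
    using base.based_ext_axioms by simp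
  have "field_norm \<iota> (\<phi> v) = eval_mpoly id (norm_poly p)
      (coord (restrict_scale \<iota> scale) (tower_basis scale as es) v)" for v
  proof -
    let ?x = "coord (restrict_scale \<iota> scale) (tower_basis scale as es) v"
    let ?e = "\<lambda>r. eval_mpoly id (component p r) ?x"
    have "base.comb ?e = eval_mpoly id p (\<lambda>i. base.comb (\<lambda>j. ?x (i * m + j)))"
      using comb_eval_component[OF E id id] by simp
    also have "\<dots> = eval_mpoly id p (coord scale es v)"
    proof (rule eval_mpoly_cong[OF vars])
      fix i assume "i < length es"
      then have "base.comb (\<lambda>j. ?x (i * m + j)) = base.comb (cf (coord scale es v i))"
        by (intro base.comb_cong coord_tower[OF field_hom_axioms vs basis es])
      then show "base.comb (\<lambda>j. ?x (i * m + j)) = coord scale es v i"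
        by (simp add: base_comb_cf)
    qed
    finally have "base.comb ?e = base.comb (cf (\<phi> v))"
      by (simp add: val base_comb_cf)
    then have "base.det_norm (cf (\<phi> v)) = base.det_norm ?e"
      using base.det_norm_mult_power[of "cf (\<phi> v)" ?e 0 ?e] by simp
    then show ?thesis
      using eval_norm_poly[OF E id id] by (simp add: field_norm_eq_det_norm[OF as])
  qed
  then show ?thesis
    using ordered_basis_tower[OF field_hom_axioms vs basis es]
      in_vars_norm_poly[OF vars] homogeneous_norm_poly[OF hom]
    by (simp add: coord_poly_def)
qed

end


section \<open>Isomorphisms as matrices\<close>

lemma unit_vec_in_coord_space: "field_closed K \<Longrightarrow> unit_vec n j \<in> coord_space K n"
  using ring_closed_simps(1,2)[of K] by (auto simp: coord_space_def unit_vec_def field_closed_def)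

text \<open>Induction on the number \<open>k\<close> of entries of \<open>v\<close> that are kept, the others being replaced by \<open>0\<close>.\<close>

lemma coord_space_linear_matrix:
  assumes K: "field_closed K" and into: "\<And>v. v \<in> coord_space K n \<Longrightarrow> f v \<in> coord_space K n"
    and add: "\<And>u v. u \<in> coord_space K n \<Longrightarrow> v \<in> coord_space K n \<Longrightarrow> f (u + v) = f u + f v"
    and smult: "\<And>c v. c \<in> K \<Longrightarrow> v \<in> coord_space K n \<Longrightarrow> f (c \<cdot>\<^sub>v v) = c \<cdot>\<^sub>v f v"
    and v: "v \<in> coord_space K n"
  shows "f v = vec n (\<lambda>i. \<Sum>j<n. f (unit_vec n j) $ i * v $ j)"
proof -
  note R = ring_closed_simps[OF field_closedD(1)[OF K]]
  define w where "w k = vec n (\<lambda>i. if i < k then v $ i else 0)" for k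
  have w: "w k \<in> coord_space K n" for k
    using v R by (auto simp: w_def coord_space_def)
  have "f (w k) = vec n (\<lambda>i. \<Sum>j<k. f (unit_vec n j) $ i * v $ j)" if "k \<le> n" for k
    using that
  proof (induction k)
    case 0
    have "0 \<cdot>\<^sub>v w 0 = w 0" by (rule eq_vecI) (simp_all add: w_def)
    then have "f (w 0) = 0 \<cdot>\<^sub>v f (w 0)" using smult[OF R(1) w] by metis
    also have "\<dots> = vec n (\<lambda>i. \<Sum>j<0. f (unit_vec n j) $ i * v $ j)"
    proof -
      have "dim_vec (f (w 0)) = n"
        using into[OF w[of 0]] by (simp add: coord_space_def)
      then show ?thesis by (intro eq_vecI) simp_all
    qed
    finally show ?case .
  next
    case (Suc k)
    have k: "v $ k \<in> K" "k < n" using v Suc.prems by (auto simp: coord_space_def)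
    have e: "unit_vec n k \<in> coord_space K n" by (rule unit_vec_in_coord_space[OF K])
    have e': "v $ k \<cdot>\<^sub>v unit_vec n k \<in> coord_space K n"
      using e k R by (auto simp: coord_space_def)
    have "w (Suc k) = w k + v $ k \<cdot>\<^sub>v unit_vec n k"
      using k by (intro eq_vecI) (auto simp: w_def unit_vec_def less_Suc_eq)
    then have "f (w (Suc k)) = f (w k) + v $ k \<cdot>\<^sub>v f (unit_vec n k)"
      by (simp add: add[OF w e'] smult[OF k(1) e])
    moreover have "dim_vec (f (unit_vec n k)) = n"
      using into[OF e] by (simp add: coord_space_def)
    ultimately show ?case
      using Suc by (intro eq_vecI) (simp_all add: mult.commute)
  qed
  moreover have "w n = v" using v by (intro eq_vecI) (auto simp: w_def coord_space_def)
  ultimately show ?thesis by force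
qed

lemma isomorphic_formsE:
  assumes "isomorphic_forms K n \<phi> \<psi>" and K: "field_closed K"
  obtains A B where "\<And>i j. i < n \<Longrightarrow> j < n \<Longrightarrow> A i j \<in> K" "\<And>i j. i < n \<Longrightarrow> j < n \<Longrightarrow> B i j \<in> K"
    "\<And>i k. i < n \<Longrightarrow> k < n \<Longrightarrow> (\<Sum>j<n. A i j * B j k) = (if i = k then 1 else 0)"
    "\<And>i k. i < n \<Longrightarrow> k < n \<Longrightarrow> (\<Sum>j<n. B i j * A j k) = (if i = k then 1 else 0)"
    "\<And>v. v \<in> coord_space K n \<Longrightarrow> \<psi> (vec n (\<lambda>i. \<Sum>j<n. A i j * v $ j)) = \<phi> v"
proof -
  let ?V = "coord_space K n"
  obtain f where bij: "bij_betw f ?V ?V"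
    and add: "\<And>u v. u \<in> ?V \<Longrightarrow> v \<in> ?V \<Longrightarrow> f (u + v) = f u + f v"
    and smult: "\<And>c v. c \<in> K \<Longrightarrow> v \<in> ?V \<Longrightarrow> f (c \<cdot>\<^sub>v v) = c \<cdot>\<^sub>v f v"
    and form: "\<And>v. v \<in> ?V \<Longrightarrow> \<psi> (f v) = \<phi> v"
    using assms(1) by (auto simp: isomorphic_forms_def)
  note R = ring_closed_simps[OF field_closedD(1)[OF K]]
  define g where "g = inv_into ?V f"
  have g: "g v \<in> ?V" "f (g v) = v" if "v \<in> ?V" for v
    using that bij bij_betw_inv_into_right[OF bij] bij_betw_inv_into[OF bij]
    by (auto simp: g_def bij_betw_apply)
  have f: "f v \<in> ?V" "g (f v) = v" if "v \<in> ?V" for v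
    using that bij bij_betw_inv_into_left[OF bij] by (auto simp: g_def bij_betw_apply)
  have V_add: "u + v \<in> ?V" if "u \<in> ?V" "v \<in> ?V" for u v
    using that R by (auto simp: coord_space_def)
  have V_smult: "c \<cdot>\<^sub>v v \<in> ?V" if "c \<in> K" "v \<in> ?V" for c v
    using that R by (auto simp: coord_space_def)
  have g_add: "g (u + v) = g u + g v" if "u \<in> ?V" "v \<in> ?V" for u v
    using f(2)[OF V_add[OF g(1)[OF that(1)] g(1)[OF that(2)]]] that by (simp add: add g)
  have g_smult: "g (c \<cdot>\<^sub>v v) = c \<cdot>\<^sub>v g v" if "c \<in> K" "v \<in> ?V" for c v
    using f(2)[OF V_smult[OF that(1) g(1)[OF that(2)]]] that by (simp add: smult g)
  have fm: "f v = vec n (\<lambda>i. \<Sum>j<n. f (unit_vec n j) $ i * v $ j)" if "v \<in> ?V" for v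
    by (rule coord_space_linear_matrix[OF K _ _ _ that]) (simp_all add: f add smult)
  have gm: "g v = vec n (\<lambda>i. \<Sum>j<n. g (unit_vec n j) $ i * v $ j)" if "v \<in> ?V" for v
    by (rule coord_space_linear_matrix[OF K _ _ _ that]) (simp_all add: g g_add g_smult)
  have e: "unit_vec n j \<in> ?V" for j by (rule unit_vec_in_coord_space[OF K])
  show thesis
  proof (rule that[of "\<lambda>i j. f (unit_vec n j) $ i" "\<lambda>i j. g (unit_vec n j) $ i"])
    fix i k assume ik: "i < n" "k < n"
    show "f (unit_vec n k) $ i \<in> K" "g (unit_vec n k) $ i \<in> K"
      using f(1)[OF e, of k] g(1)[OF e, of k] ik by (auto simp: coord_space_def)
    have "f (g (unit_vec n k)) $ i = (\<Sum>j<n. f (unit_vec n j) $ i * g (unit_vec n k) $ j)"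
      by (subst fm[OF g(1)[OF e]]) (simp add: ik)
    then show "(\<Sum>j<n. f (unit_vec n j) $ i * g (unit_vec n k) $ j) = (if i = k then 1 else 0)"
      using ik by (simp add: g(2)[OF e])
    have "g (f (unit_vec n k)) $ i = (\<Sum>j<n. g (unit_vec n j) $ i * f (unit_vec n k) $ j)"
      by (subst gm[OF f(1)[OF e]]) (simp add: ik)
    then show "(\<Sum>j<n. g (unit_vec n j) $ i * f (unit_vec n k) $ j) = (if i = k then 1 else 0)"
      using ik by (simp add: f(2)[OF e])
  next
    fix v assume v: "v \<in> ?V"
    then show "\<psi> (vec n (\<lambda>i. \<Sum>j<n. f (unit_vec n j) $ i * v $ j)) = \<phi> v"
      using form[OF v] by (simp only: fm[OF v, symmetric])
  qed
qed

lemma isomorphic_formsI: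
  fixes A B :: "nat \<Rightarrow> nat \<Rightarrow> 'a::field"
  assumes K: "field_closed K"
    and A: "\<And>i j. i < n \<Longrightarrow> j < n \<Longrightarrow> A i j \<in> K" and B: "\<And>i j. i < n \<Longrightarrow> j < n \<Longrightarrow> B i j \<in> K"
    and AB: "\<And>x i. i < n \<Longrightarrow> (\<Sum>j<n. A i j * (\<Sum>k<n. B j k * x k)) = x i"
    and BA: "\<And>x i. i < n \<Longrightarrow> (\<Sum>j<n. B i j * (\<Sum>k<n. A j k * x k)) = x i"
    and form: "\<And>v. v \<in> coord_space K n \<Longrightarrow> \<psi> (vec n (\<lambda>i. \<Sum>j<n. A i j * v $ j)) = \<phi> v"
  shows "isomorphic_forms K n \<phi> \<psi>"
proof -
  let ?V = "coord_space K n"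
  let ?f = "\<lambda>(A :: nat \<Rightarrow> nat \<Rightarrow> 'a) v. vec n (\<lambda>i. \<Sum>j<n. A i j * v $ j)"
  note ring = field_closedD(1)[OF K]
  note R = ring_closed_simps[OF ring]
  have into: "?f C v \<in> ?V" if "v \<in> ?V" "\<And>i j. i < n \<Longrightarrow> j < n \<Longrightarrow> C i j \<in> K" for C v
    using that by (auto simp: coord_space_def intro!: ring_closed_sum[OF ring] R)
  have "bij_betw (?f A) ?V ?V"
  proof (rule bij_betw_byWitness[of _ "?f B"])
    show "\<forall>v\<in>?V. ?f B (?f A v) = v" "\<forall>v\<in>?V. ?f A (?f B v) = v"
      by (auto simp: coord_space_def AB BA intro!: eq_vecI)
  qed (use into A B in blast)+
  moreover have "?f A (u + v) = ?f A u + ?f A v" if "u \<in> ?V" "v \<in> ?V" for u v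
    using that by (intro eq_vecI) (auto simp: coord_space_def algebra_simps sum.distrib)
  moreover have "?f A (c \<cdot>\<^sub>v v) = c \<cdot>\<^sub>v ?f A v" if "v \<in> ?V" for c v
    using that by (intro eq_vecI) (auto simp: coord_space_def sum_distrib_left algebra_simps)
  ultimately show ?thesis
    unfolding isomorphic_forms_def using form by (intro exI[of _ "?f A"]) blast
qed

lemma matrix_inverse_apply:
  fixes A B :: "nat \<Rightarrow> nat \<Rightarrow> 'a::comm_ring_1"
  assumes "\<And>k. k < n \<Longrightarrow> (\<Sum>j<n. A i j * B j k) = (if i = k then 1 else 0)" "i < n"
  shows "(\<Sum>j<n. A i j * (\<Sum>k<n. B j k * x k)) = x i"
proof -
  have "(\<Sum>j<n. A i j * (\<Sum>k<n. B j k * x k)) = (\<Sum>j<n. \<Sum>k<n. A i j * B j k * x k)"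
    by (simp add: sum_distrib_left mult.assoc)
  also have "\<dots> = (\<Sum>k<n. (\<Sum>j<n. A i j * B j k) * x k)"
    by (subst sum.swap) (simp add: sum_distrib_right)
  also have "\<dots> = (\<Sum>k<n. if i = k then x k else 0)"
    using assms(1) by (intro sum.cong) auto
  also have "\<dots> = x i" using assms(2) by simp
  finally show ?thesis .
qed

text \<open>The difference of \<open>p(AX)\<close> and \<open>g p(X)\<close> as a polynomial over the field of the entries of \<open>A\<close>. As a
  polynomial, its coefficients can be mapped to another ring.\<close>

definition similarity_defect ::
  "('f \<Rightarrow> 'a) \<Rightarrow> nat \<Rightarrow> 'f::zero mpoly \<Rightarrow> (nat \<Rightarrow> nat \<Rightarrow> 'a) \<Rightarrow> 'a \<Rightarrow> 'a::comm_ring_1 mpoly" where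
  "similarity_defect h n p A g =
    eval_mpoly (\<lambda>c. mconst (h c)) p (\<lambda>i. \<Sum>j<n. mconst (A i j) * mvar j) -
    mconst g * eval_mpoly (\<lambda>c. mconst (h c)) p mvar"

lemma eval_similarity_defect:
  assumes "comm_ring_hom \<tau>"
  shows "eval_mpoly \<tau> (similarity_defect h n p A g) v =
    eval_mpoly (\<lambda>c. \<tau> (h c)) p (\<lambda>i. \<Sum>j<n. \<tau> (A i j) * v j) -
    \<tau> g * eval_mpoly (\<lambda>c. \<tau> (h c)) p v"
proof -
  interpret \<tau>: comm_ring_hom \<tau> by fact
  interpret e: comm_ring_hom "\<lambda>p. eval_mpoly \<tau> p v" by (rule comm_ring_hom_eval_mpoly) fact
  show ?thesis
    by (simp add: similarity_defect_def e.hom_minus e.hom_mult e.hom_sum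
        hom_eval_mpoly[OF e.comm_ring_hom_axioms] eval_mpoly_mconst eval_mpoly_mvar)
qed

text \<open>A similarity over an infinite field is an identity of polynomials, so it holds after applying a
  homomorphism to its coefficients, and then for arguments from the new ring.\<close>

lemma similarity_extends:
  fixes A :: "nat \<Rightarrow> nat \<Rightarrow> 'a::field" and \<sigma> :: "'a \<Rightarrow> 'b::comm_ring_1"
  assumes p: "in_vars n p" and inf: "n > 0 \<Longrightarrow> infinite R" and \<sigma>: "comm_ring_hom \<sigma>"
    and eq: "\<And>v. (\<And>i. i < n \<Longrightarrow> v i \<in> R) \<Longrightarrow>
      eval_mpoly h p (\<lambda>i. \<Sum>j<n. A i j * v j) = g * eval_mpoly h p v"
  shows "eval_mpoly (\<lambda>c. \<sigma> (h c)) p (\<lambda>i. \<Sum>j<n. \<sigma> (A i j) * v j) =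
    \<sigma> g * eval_mpoly (\<lambda>c. \<sigma> (h c)) p v"
proof -
  let ?D = "similarity_defect h n p A g"
  have "?D = 0"
  proof (rule mpoly_eq_0I[OF _ inf])
    note P = ring_closed_in_vars[of n]
    have "?D \<in> {q. in_vars n q}"
      unfolding similarity_defect_def
      by (intro ring_closed_diff[OF P] ring_closed_simps(5)[OF P] eval_mpoly_closed[OF P p]
          ring_closed_sum[OF P]) (simp_all add: in_vars_mconst in_vars_mvar)
    then show "in_vars n ?D" by simp
    have "comm_ring_hom (id :: 'a \<Rightarrow> 'a)" by unfold_locales simp_all
    then show "eval_mpoly id ?D v = 0" if "\<And>i. i < n \<Longrightarrow> v i \<in> R" for v
      using eq[OF that] by (simp add: eval_similarity_defect)
  qed
  then have "eval_mpoly \<sigma> ?D v = 0" by (simp add: eval_mpoly_alt)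
  then show ?thesis by (simp add: eval_similarity_defect[OF \<sigma>])
qed

section \<open>Transfer of similarities along the norm\<close>

context ext_basis
begin

text \<open>The vector over \<open>l(X)\<close> with coordinates \<open>x\<close> over \<open>k(X)\<close>.\<close>

definition block :: "(nat \<Rightarrow> 'k ratfun) \<Rightarrow> nat \<Rightarrow> 'l ratfun" where
  "block x i = gen.comb (\<lambda>j. x (i * m + j))"

text \<open>The embedding \<open>x\<^sub>i \<mapsto> \<Sum>\<^sub>j a\<^sub>j x\<^sub>i\<^sub>j\<close> of the field of rational functions over \<open>l\<close> into itself.\<close>

definition spread :: "'l ratfun \<Rightarrow> 'l ratfun" where
  "spread = fract_ext (\<lambda>p. eval_mpoly rat_const p (block rat_var))"

lemma norm_poly_similarity:
  assumes "eval_mpoly rat_const p (block x) ^ s * eval_mpoly rat_const p (block y) =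
    eval_mpoly rat_const p (block z)"
  shows "eval_mpoly rat_const (norm_poly p) x ^ s * eval_mpoly rat_const (norm_poly p) y =
    eval_mpoly rat_const (norm_poly p) z"
proof -
  note E = gen.based_ext_axioms comm_ring_hom_rat_const comm_ring_hom_rat_const lift_const
  have comb: "gen.comb (\<lambda>r. eval_mpoly rat_const (component p r) x) = eval_mpoly rat_const p (block x)" for x
    unfolding block_def by (rule comb_eval_component[OF E])
  show ?thesis
    unfolding eval_norm_poly[OF E]
    by (rule gen.det_norm_mult_power[symmetric]) (simp add: comb assms)
qed

lemma eval_block_var: "eval_mpoly rat_const p (block rat_var) = Fract (expand p) 1"
proof -
  interpret F: comm_ring_hom "\<lambda>p::'l mpoly. Fract p 1" by (rule comm_ring_hom_Fract)
  have "Fract (generic_elt i) 1 = block rat_var i" for i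
  proof -
    have "block rat_var i = (\<Sum>j<m. rat_const (as ! j) * rat_var (i * m + j))"
      by (simp add: block_def gen.comb_def lift_var mult.commute)
    then show ?thesis
      by (simp only: generic_elt_def F.hom_sum F.hom_mult rat_const_eq rat_var_eq)
  qed
  then show ?thesis
    unfolding expand_def by (subst hom_eval_mpoly[OF F.comm_ring_hom_axioms]) (simp flip: rat_const_eq)
qed

lemma eval_block_var_eq_0D: "eval_mpoly rat_const p (block rat_var) = 0 \<Longrightarrow> p = 0"
  by (rule expand_eq_0D) (simp add: eval_block_var Fract_eq_0_iff)

lemma field_hom_spread: "field_hom spread"
  unfolding spread_def
  by (rule field_hom_fract_ext[OF comm_ring_hom_eval_mpoly[OF comm_ring_hom_rat_const]
        eval_block_var_eq_0D])

lemma spread_const: "spread (rat_const c) = rat_const c"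
  and spread_var: "spread (rat_var i) = block rat_var i"
  unfolding spread_def by (rule fract_ext_eval[OF comm_ring_hom_rat_const eval_block_var_eq_0D]; simp)+

lemma comm_ring_hom_spread: "comm_ring_hom spread"
proof -
  interpret s: field_hom spread by (rule field_hom_spread)
  show ?thesis by unfold_locales
qed

lemma spread_eval: "spread (eval_mpoly rat_const p x) = eval_mpoly rat_const p (\<lambda>i. spread (x i))"
  by (simp add: hom_eval_mpoly[OF comm_ring_hom_spread] spread_const)

lemma field_closed_gen_combs: "field_closed (gen.combs (rat_funs N))"
  by (rule gen.field_closed_combs[OF field_closed_rat_funs]) (rule rat_const_in_rat_funs)+

lemma spread_in_combs:
  assumes "z \<in> rat_funs n"
  shows "spread z \<in> gen.combs (rat_funs (n * m))"
  unfolding spread_def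
proof (rule fract_ext_closed[OF comm_ring_hom_rat_const eval_block_var_eq_0D field_closed_gen_combs _ _ assms])
  let ?S = "gen.combs (rat_funs (n * m))"
  note S = field_closedD(1)[OF field_closed_gen_combs, of "n * m"]
  show "rat_const c \<in> ?S" for c
  proof -
    have "rat_const c = gen.comb (\<lambda>r. rat_const (cf c r))"
    proof -
      interpret c: comm_ring_hom "rat_const :: 'l \<Rightarrow> _" by (rule comm_ring_hom_rat_const)
      show ?thesis
        using arg_cong[OF cf_sum[of c], of rat_const]
        by (simp add: gen.comb_def lift_const c.hom_sum c.hom_mult)
    qed
    then show ?thesis by (simp add: gen.combsI rat_const_in_rat_funs)
  qed
  show "block rat_var i \<in> ?S" if "i < n" for i
    unfolding block_def using that by (intro gen.combsI rat_var_in_rat_funs index_lt)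
qed simp

lemma spread_coords:
  assumes "z \<in> rat_funs n"
  obtains c where "spread z = gen.comb c" "\<And>r. r < m \<Longrightarrow> c r \<in> rat_funs (n * m)"
  using spread_in_combs[OF assms] by (rule gen.combsE) blast

text \<open>The spread identity has the generic vectors of the new variables on the left. The values \<open>z\<^sub>i\<close> are
  spread as well and then split into coordinates \<open>w\<close> over the rational functions over \<open>k\<close>.\<close>

lemma multiplicative_norm_poly:
  assumes p: "in_vars n p" and z: "\<And>i. i < n \<Longrightarrow> z i \<in> rat_funs (2 * n)"
    and eq: "generic_X p ^ s * generic_Y n p = eval_mpoly rat_const p z"
  shows "\<exists>z. (\<forall>i<n * m. z i \<in> rat_funs (2 * (n * m))) \<and>
    generic_X (norm_poly p) ^ s * generic_Y (n * m) (norm_poly p) = eval_mpoly rat_const (norm_poly p) z"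
proof -
  interpret spread: comm_ring_hom spread by (rule comm_ring_hom_spread)
  have "\<exists>c. spread (z i) = gen.comb c \<and> (\<forall>r<m. c r \<in> rat_funs (2 * n * m))" if "i < n" for i
    using spread_coords[OF z[OF that]] by metis
  then obtain c where c: "\<And>i. i < n \<Longrightarrow> spread (z i) = gen.comb (c i)"
    "\<And>i r. i < n \<Longrightarrow> r < m \<Longrightarrow> c i r \<in> rat_funs (2 * n * m)" by metis
  define w where "w s = c (s div m) (s mod m)" for s
  have block_w: "block w i = spread (z i)" if "i < n" for i
    using that c(1) by (auto simp: block_def w_def div_mult_self_add intro!: gen.comb_cong)
  (* The variable x_(n+i) of Y spreads to the block with first index (n+i)m = nm+im. *)
  have block_Y: "block (\<lambda>s. rat_var (n * m + s)) = (\<lambda>i. block rat_var (n + i))"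
    by (simp add: fun_eq_iff block_def algebra_simps)
  have "eval_mpoly rat_const p (block rat_var) ^ s *
      eval_mpoly rat_const p (block (\<lambda>s. rat_var (n * m + s))) = spread (generic_X p ^ s * generic_Y n p)"
    by (simp add: generic_X_def generic_Y_def spread.hom_mult spread.hom_power spread_eval spread_var block_Y)
  also have "\<dots> = eval_mpoly rat_const p (block w)"
    unfolding eq spread_eval by (rule eval_mpoly_cong[OF p]) (simp add: block_w)
  finally have "generic_X (norm_poly p) ^ s * generic_Y (n * m) (norm_poly p) =
      eval_mpoly rat_const (norm_poly p) w"
    unfolding generic_X_def generic_Y_def by (rule norm_poly_similarity)
  moreover have "w s \<in> rat_funs (2 * (n * m))" if "s < n * m" for s
  proof -
    have "s div m < n" "s mod m < m"
      using that degree_pos by (simp_all add: less_mult_imp_div_less)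
    then show ?thesis using c(2) by (simp add: w_def mult.assoc)
  qed
  ultimately show ?thesis by blast
qed

text \<open>Restriction of scalars for a matrix: the entry with coordinates \<open>c i j\<close> is replaced by its
  multiplication matrix.\<close>

definition block_matrix :: "(nat \<Rightarrow> nat \<Rightarrow> nat \<Rightarrow> 'k ratfun) \<Rightarrow> nat \<Rightarrow> nat \<Rightarrow> 'k ratfun" where
  "block_matrix c s t = gen.mult_mat (c (s div m) (t div m)) $$ (s mod m, t mod m)"

lemma block_matrix_apply:
  "block (\<lambda>s. \<Sum>t<n * m. block_matrix c s t * x t) i = (\<Sum>j<n. gen.comb (c i j) * block x j)"
proof -
  have "block (\<lambda>s. \<Sum>t<n * m. block_matrix c s t * x t) i =
      gen.comb (\<lambda>r. \<Sum>j<n. \<Sum>q<m. gen.mult_mat (c i j) $$ (r, q) * x (j * m + q))"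
    unfolding block_def
    by (intro gen.comb_cong) (simp add: sum_lessThan_mult block_matrix_def div_mult_self_add)
  also have "\<dots> = (\<Sum>j<n. gen.comb (\<lambda>r. \<Sum>q<m. gen.mult_mat (c i j) $$ (r, q) * x (j * m + q)))"
    by (rule gen.comb_sum)
  finally show ?thesis by (simp add: gen.comb_mult block_def)
qed

lemma block_matrix_in_rat_funs:
  assumes "\<And>i j r. i < n \<Longrightarrow> j < n \<Longrightarrow> r < m \<Longrightarrow> c i j r \<in> rat_funs N" "s < n * m" "t < n * m"
  shows "block_matrix c s t \<in> rat_funs N"
proof -
  note ring = field_closedD(1)[OF field_closed_rat_funs, of N]
  have "s div m < n" "s mod m < m" "t div m < n" "t mod m < m"
    using assms(2,3) degree_pos by (simp_all add: less_mult_imp_div_less)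
  then show ?thesis
    using assms(1)
    by (auto simp: block_matrix_def gen.mult_mat_def
        intro!: ring_closed_sum[OF ring] ring_closed_simps(5)[OF ring] rat_const_in_rat_funs)
qed

lemma block_eqD:
  assumes "\<And>i. i < n \<Longrightarrow> block x i = block y i" "s < n * m"
  shows "x s = y s"
proof -
  have "s div m < n" "s mod m < m"
    using assms(2) degree_pos by (simp_all add: less_mult_imp_div_less)
  then have "x (s div m * m + s mod m) = y (s div m * m + s mod m)"
    using assms(1)[of "s div m"] gen.comb_eqD unfolding block_def by blast
  then show ?thesis by simp
qed

text \<open>The matrix \<open>A\<close> of the isomorphism is spread and its scalars restricted. The inverse \<open>B\<close> is treated
  in the same way, so that the new map is bijective because \<open>block\<close> determines the coordinates.\<close>

lemma strongly_multiplicative_norm_poly: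
  assumes p: "in_vars n p"
    and iso: "isomorphic_forms (rat_funs n) n (\<lambda>v. generic_X p ^ s * scalar_ext p v) (scalar_ext p)"
  shows "isomorphic_forms (rat_funs (n * m)) (n * m)
    (\<lambda>v. generic_X (norm_poly p) ^ s * scalar_ext (norm_poly p) v) (scalar_ext (norm_poly p))"
proof -
  interpret spread: comm_ring_hom spread by (rule comm_ring_hom_spread)
  obtain A B where AK: "\<And>i j. i < n \<Longrightarrow> j < n \<Longrightarrow> A i j \<in> rat_funs n"
    and BK: "\<And>i j. i < n \<Longrightarrow> j < n \<Longrightarrow> B i j \<in> rat_funs n"
    and AB: "\<And>i k. i < n \<Longrightarrow> k < n \<Longrightarrow> (\<Sum>j<n. A i j * B j k) = (if i = k then 1 else 0)"
    and BA: "\<And>i k. i < n \<Longrightarrow> k < n \<Longrightarrow> (\<Sum>j<n. B i j * A j k) = (if i = k then 1 else 0)"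
    and form: "\<And>v. v \<in> coord_space (rat_funs n) n \<Longrightarrow>
      scalar_ext p (vec n (\<lambda>i. \<Sum>j<n. A i j * v $ j)) = generic_X p ^ s * scalar_ext p v"
    using isomorphic_formsE[OF iso field_closed_rat_funs] by blast
  have coords: "\<exists>c. \<forall>i<n. \<forall>j<n. spread (C i j) = gen.comb (c i j) \<and> (\<forall>r<m. c i j r \<in> rat_funs (n * m))"
    if "\<And>i j. i < n \<Longrightarrow> j < n \<Longrightarrow> C i j \<in> rat_funs n" for C
  proof -
    have "\<forall>i j. \<exists>c. i < n \<longrightarrow> j < n \<longrightarrow> spread (C i j) = gen.comb c \<and> (\<forall>r<m. c r \<in> rat_funs (n * m))"
      using spread_coords[OF that] by metis
    then show ?thesis by metis
  qed
  obtain a where a: "\<And>i j. i < n \<Longrightarrow> j < n \<Longrightarrow> spread (A i j) = gen.comb (a i j)"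
    "\<And>i j r. i < n \<Longrightarrow> j < n \<Longrightarrow> r < m \<Longrightarrow> a i j r \<in> rat_funs (n * m)"
    using coords[of A] AK by blast
  obtain b where b: "\<And>i j. i < n \<Longrightarrow> j < n \<Longrightarrow> spread (B i j) = gen.comb (b i j)"
    "\<And>i j r. i < n \<Longrightarrow> j < n \<Longrightarrow> r < m \<Longrightarrow> b i j r \<in> rat_funs (n * m)"
    using coords[of B] BK by blast
  have spread_if: "spread (if P then 1 else 0) = (if P then 1 else 0)" for P by simp
  have ab: "(\<Sum>j<n. gen.comb (a i j) * gen.comb (b j k)) = (if i = k then 1 else 0)"
    and ba: "(\<Sum>j<n. gen.comb (b i j) * gen.comb (a j k)) = (if i = k then 1 else 0)"
    if "i < n" "k < n" for i k
    using arg_cong[OF AB[OF that], of spread] arg_cong[OF BA[OF that], of spread] that a(1) b(1)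
    by (simp_all add: spread.hom_sum spread.hom_mult spread_if)
  have ab_apply: "(\<Sum>j<n. gen.comb (a i j) * (\<Sum>k<n. gen.comb (b j k) * y k)) = y i"
    and ba_apply: "(\<Sum>j<n. gen.comb (b i j) * (\<Sum>k<n. gen.comb (a j k) * y k)) = y i"
    if "i < n" for i y
    using matrix_inverse_apply[where A = "\<lambda>i j. gen.comb (a i j)" and B = "\<lambda>i j. gen.comb (b i j)",
        OF ab[OF that] that]
      matrix_inverse_apply[where A = "\<lambda>i j. gen.comb (b i j)" and B = "\<lambda>i j. gen.comb (a i j)",
        OF ba[OF that] that] by auto
  show ?thesis
  proof (rule isomorphic_formsI[OF field_closed_rat_funs,
        where A = "block_matrix a" and B = "block_matrix b"])
    show "block_matrix a i j \<in> rat_funs (n * m)" "block_matrix b i j \<in> rat_funs (n * m)"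
      if "i < n * m" "j < n * m" for i j
      using that a(2) b(2) block_matrix_in_rat_funs by blast+
    show "(\<Sum>j<n * m. block_matrix a i j * (\<Sum>k<n * m. block_matrix b j k * x k)) = x i"
      if "i < n * m" for x i
      by (rule block_eqD[OF _ that]) (simp add: block_matrix_apply ab_apply)
    show "(\<Sum>j<n * m. block_matrix b i j * (\<Sum>k<n * m. block_matrix a j k * x k)) = x i"
      if "i < n * m" for x i
      by (rule block_eqD[OF _ that]) (simp add: block_matrix_apply ba_apply)
    fix v :: "'k ratfun vec"
    let ?w = "\<lambda>s. \<Sum>t<n * m. block_matrix a s t * v $ t"
    have "eval_mpoly rat_const p (block ?w) =
        eval_mpoly rat_const p (\<lambda>i. \<Sum>j<n. spread (A i j) * block (($) v) j)"
      by (rule eval_mpoly_cong[OF p]) (simp add: block_matrix_apply a(1))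
    also have "\<dots> = spread (generic_X p ^ s) * eval_mpoly rat_const p (block (($) v))"
    proof -
      have "eval_mpoly rat_const p (\<lambda>i. \<Sum>j<n. A i j * x j) = generic_X p ^ s * eval_mpoly rat_const p x"
        if x: "\<And>i. i < n \<Longrightarrow> x i \<in> rat_funs n" for x
      proof -
        have "scalar_ext p (vec n (\<lambda>i. \<Sum>j<n. A i j * vec n x $ j)) =
            generic_X p ^ s * scalar_ext p (vec n x)"
          by (rule form) (simp add: coord_space_def x)
        moreover have "scalar_ext p (vec n y) = eval_mpoly rat_const p y" for y
          unfolding scalar_ext_def by (rule eval_mpoly_cong[OF p]) simp
        ultimately show ?thesis by simp
      qed
      from similarity_extends[OF p infinite_rat_funs comm_ring_hom_spread this]
      show ?thesis by (simp add: spread_const)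
    qed
    also have "\<dots> = eval_mpoly rat_const p (block rat_var) ^ s * eval_mpoly rat_const p (block (($) v))"
      by (simp add: spread.hom_power generic_X_def spread_eval spread_var)
    finally have "eval_mpoly rat_const (norm_poly p) rat_var ^ s * eval_mpoly rat_const (norm_poly p) (($) v) =
        eval_mpoly rat_const (norm_poly p) ?w"
      by (intro norm_poly_similarity) simp
    moreover have "scalar_ext (norm_poly p) (vec (n * m) ?w) = eval_mpoly rat_const (norm_poly p) ?w"
      unfolding scalar_ext_def by (rule eval_mpoly_cong[OF in_vars_norm_poly[OF p]]) simp
    ultimately show "scalar_ext (norm_poly p) (vec (n * m) ?w) =
        generic_X (norm_poly p) ^ s * scalar_ext (norm_poly p) v"
      by (simp add: generic_X_def scalar_ext_def)
  qed
qed

end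

text \<open>The norm polynomial for the basis chosen in the definition of \<open>field_norm\<close> serves all four
  properties.\<close>

theorem proposition3:
  fixes \<iota> :: "'k::field \<Rightarrow> 'l::field"
    and scale :: "'l \<Rightarrow> 'v::ab_group_add \<Rightarrow> 'v"
    and B :: "'v set"
    and \<phi>\<^sub>0 :: "'v \<Rightarrow> 'l"
    and \<phi> :: "'v \<Rightarrow> 'k"
    and d\<^sub>0 :: nat
  assumes "finite_ext \<iota>" and "separable_ext \<iota>"
    and "finite_dimensional_vector_space scale B"
    and "d\<^sub>0 \<ge> 1"
    and "CHAR('k) = 0 \<or> CHAR('k) > ext_degree \<iota> * d\<^sub>0"
    and "is_form scale d\<^sub>0 \<phi>\<^sub>0" and "nondegenerate scale d\<^sub>0 \<phi>\<^sub>0"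
    and "\<phi> = (\<lambda>v. field_norm \<iota> (\<phi>\<^sub>0 v))"
  shows
    "(strongly_multiplicative_form scale d\<^sub>0 \<phi>\<^sub>0 \<longrightarrow>
        is_form (restrict_scale \<iota> scale) (ext_degree \<iota> * d\<^sub>0) \<phi> \<and>
        strongly_multiplicative_form (restrict_scale \<iota> scale) (ext_degree \<iota> * d\<^sub>0) \<phi>) \<and>
     (strongly_jordan_multiplicative_form scale d\<^sub>0 \<phi>\<^sub>0 \<longrightarrow>
        is_form (restrict_scale \<iota> scale) (ext_degree \<iota> * d\<^sub>0) \<phi> \<and>
        strongly_jordan_multiplicative_form (restrict_scale \<iota> scale) (ext_degree \<iota> * d\<^sub>0) \<phi>) \<and>
     (multiplicative_form scale d\<^sub>0 \<phi>\<^sub>0 \<longrightarrow>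
        is_form (restrict_scale \<iota> scale) (ext_degree \<iota> * d\<^sub>0) \<phi> \<and>
        multiplicative_form (restrict_scale \<iota> scale) (ext_degree \<iota> * d\<^sub>0) \<phi>) \<and>
     (jordan_multiplicative_form scale d\<^sub>0 \<phi>\<^sub>0 \<longrightarrow>
        is_form (restrict_scale \<iota> scale) (ext_degree \<iota> * d\<^sub>0) \<phi> \<and>
        jordan_multiplicative_form (restrict_scale \<iota> scale) (ext_degree \<iota> * d\<^sub>0) \<phi>)"
proof -
  define as where "as = (SOME as. ordered_basis (ext_scale \<iota>) as)"
  have basis: "ordered_basis (ext_scale \<iota>) as"
    unfolding as_def by (rule someI_ex) (rule finite_ext_basis_exists[OF assms(1)])
  have hom: "field_hom \<iota>"
    using assms(1) by (simp add: finite_ext_def)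
  interpret ext_basis \<iota> as
    using hom basis by (simp add: ext_basis_def ext_basis_axioms_def)
  interpret V: finite_dimensional_vector_space scale B by fact
  have degree: "ext_degree \<iota> = m"
    by (rule length_ext_basis[OF assms(1) basis, symmetric])
  have transfer: "is_form (restrict_scale \<iota> scale) (ext_degree \<iota> * d\<^sub>0) \<phi> \<and>
      via_basis P (restrict_scale \<iota> scale) (ext_degree \<iota> * d\<^sub>0) \<phi>"
    if form: "via_basis P' scale d\<^sub>0 \<phi>\<^sub>0"
      and step: "\<And>n p. in_vars n p \<Longrightarrow> P' n p \<Longrightarrow> P (n * m) (norm_poly p)" for P P'
  proof -
    obtain es p where p: "coord_poly scale es d\<^sub>0 \<phi>\<^sub>0 p" and "P' (length es) p"
      using form by (auto simp: via_basis_def)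
    then have "P (length es * m) (norm_poly p)"
      by (intro step) (auto simp: coord_poly_def)
    moreover have "coord_poly (restrict_scale \<iota> scale) (tower_basis scale as es) (m * d\<^sub>0) \<phi> (norm_poly p)"
      unfolding assms(8) by (rule coord_poly_norm_poly[OF V.vector_space_axioms p as_def])
    ultimately show ?thesis
      by (auto simp: is_form_def via_basis_def degree intro!: exI[of _ "tower_basis scale as es"])
  qed
  show ?thesis
  proof (intro conjI[of "_ \<longrightarrow> _"] impI)
    show "is_form (restrict_scale \<iota> scale) (ext_degree \<iota> * d\<^sub>0) \<phi> \<and>
        strongly_multiplicative_form (restrict_scale \<iota> scale) (ext_degree \<iota> * d\<^sub>0) \<phi>"
      if "strongly_multiplicative_form scale d\<^sub>0 \<phi>\<^sub>0"
      using that
    proof (rule transfer)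
      show "strongly_multiplicative_poly (n * m) (norm_poly p)"
        if "in_vars n p" "strongly_multiplicative_poly n p" for n p
        using strongly_multiplicative_norm_poly[of n p 1] that
        by (simp add: strongly_multiplicative_poly_def)
    qed
    show "is_form (restrict_scale \<iota> scale) (ext_degree \<iota> * d\<^sub>0) \<phi> \<and>
        strongly_jordan_multiplicative_form (restrict_scale \<iota> scale) (ext_degree \<iota> * d\<^sub>0) \<phi>"
      if "strongly_jordan_multiplicative_form scale d\<^sub>0 \<phi>\<^sub>0"
      using that
    proof (rule transfer)
      show "strongly_jordan_multiplicative_poly (n * m) (norm_poly p)"
        if "in_vars n p" "strongly_jordan_multiplicative_poly n p" for n p
        using strongly_multiplicative_norm_poly[of n p 2] that
        by (simp add: strongly_jordan_multiplicative_poly_def)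
    qed
    show "is_form (restrict_scale \<iota> scale) (ext_degree \<iota> * d\<^sub>0) \<phi> \<and>
        multiplicative_form (restrict_scale \<iota> scale) (ext_degree \<iota> * d\<^sub>0) \<phi>"
      if "multiplicative_form scale d\<^sub>0 \<phi>\<^sub>0"
      using that
    proof (rule transfer)
      show "multiplicative_poly (n * m) (norm_poly p)"
        if "in_vars n p" "multiplicative_poly n p" for n p
        using multiplicative_norm_poly[of n p _ 1] that
        unfolding multiplicative_poly_def power_one_right by blast
    qed
    show "is_form (restrict_scale \<iota> scale) (ext_degree \<iota> * d\<^sub>0) \<phi> \<and>
        jordan_multiplicative_form (restrict_scale \<iota> scale) (ext_degree \<iota> * d\<^sub>0) \<phi>"
      if "jordan_multiplicative_form scale d\<^sub>0 \<phi>\<^sub>0"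
      using that
    proof (rule transfer)
      show "jordan_multiplicative_poly (n * m) (norm_poly p)"
        if "in_vars n p" "jordan_multiplicative_poly n p" for n p
        using multiplicative_norm_poly[of n p _ 2] that
        unfolding jordan_multiplicative_poly_def by blast
    qed
  qed
qed

end
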